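(* Let $s,t$ be positive integers with $t \ge \max\{3, (s-1)!+1\}$. Then $\mathrm{ex}_2(K_n, \mathcal{F}_{s,t}) = \Theta(n^{2-\frac{1}{s}})$ for all sufficiently large $n$, where $\mathcal{F}_{s,t} = \{K_{s,t}, S_{t,t}\}$.
   Context: A $2$-edge-coloring of $K_n$ is a partition $E(K_n) = E(R)\cup E(B)$ into red and blue edges; $R,B$ are the red and blue graphs and $e(R),e(B)$ their numbers of edges. The coloring contains an induced monochromatic copy of a graph $H$ if there is $U\subseteq V(K_n)$ with $|U|=|V(H)|$ such that the red edges inside $U$, or the blue edges inside $U$, form a graph isomorphic to $H$. $K_{s,t}$ is the complete bipartite graph with parts of sizes $s,t$; $S_{s,t}$ is the complete split graph consisting of a clique on $s$ vertices, an independent set on $t$ vertices, and all edges between them. For a family $\mathcal{F}$ of graphs containing no complete or empty graphs, $\mathrm{ex}_2(K_n,\mathcal{F})$ is the largest integer $m \le \frac12\binom{n}{2}$ such that (for large $n$) there is a $2$-edge-coloring of $K_n$ whose smaller color class has exactly $m$ edges and which contains no induced monochromatic member of $\mathcal{F}$ (and $\infty$ if no such bound exists); equivalently, it is the least $m$ such that every $2$-edge-coloring of $K_n$ with more than $m$ edges in each color contains an induced monochromatic member of $\mathcal{F}$. Asymptotic notation is as $n\to\infty$, with constants depending on $s,t$. *)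

theory Defs
  imports
    "HOL-Library.Extended_Nat"
    "HOL-Library.Landau_Symbols"
    "HOL-Analysis.Analysis"
begin

text \<open>A finite simple graph is a pair of a vertex set and a set of two-element subsets of it.\<close>

type_synonym 'a sgraph = "'a set \<times> 'a set set"

definition verts :: "'a sgraph \<Rightarrow> 'a set" where
  "verts G = fst G"

definition edges :: "'a sgraph \<Rightarrow> 'a set set" where
  "edges G = snd G"

definition all_edges :: "'a set \<Rightarrow> 'a set set" where
  "all_edges V = {e. e \<subseteq> V \<and> card e = 2}"

definition sgraph_iso :: "'a sgraph \<Rightarrow> 'b sgraph \<Rightarrow> bool" where
  "sgraph_iso G H \<longleftrightarrow>
     (\<exists>f. bij_betw f (verts G) (verts H) \<and>
          (\<forall>u\<in>verts G. \<forall>v\<in>verts G. {u, v} \<in> edges G \<longleftrightarrow> {f u, f v} \<in> edges H))"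

text \<open>
  The vertices of \<open>K\<^bsub>s,t\<^esub>\<close> and \<open>S\<^bsub>s,t\<^esub>\<close> are tagged by the part they belong to:
  \<open>Inl\<close> for the part of size \<open>s\<close> (the clique of \<open>S\<^bsub>s,t\<^esub>\<close>), \<open>Inr\<close> for the part of
  size \<open>t\<close>.
\<close>

definition complete_bipartite :: "nat \<Rightarrow> nat \<Rightarrow> (nat + nat) sgraph" where
  "complete_bipartite s t =
     ({..<s} <+> {..<t}, {{Inl i, Inr j} | i j. i < s \<and> j < t})"

definition complete_split :: "nat \<Rightarrow> nat \<Rightarrow> (nat + nat) sgraph" where
  "complete_split s t =
     ({..<s} <+> {..<t},
      {{Inl i, Inl j} | i j. i < s \<and> j < s \<and> i \<noteq> j} \<union>
      {{Inl i, Inr j} | i j. i < s \<and> j < t})"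

definition family_st :: "nat \<Rightarrow> nat \<Rightarrow> (nat + nat) sgraph set" where
  "family_st s t = {complete_bipartite s t, complete_split t t}"

text \<open>\<open>K\<^sub>n\<close> has vertex set \<open>{..<n}\<close>; a colouring is given by its red and blue edge sets.\<close>

definition two_edge_coloring :: "nat \<Rightarrow> nat set set \<Rightarrow> nat set set \<Rightarrow> bool" where
  "two_edge_coloring n R B \<longleftrightarrow> R \<union> B = all_edges {..<n} \<and> R \<inter> B = {}"

definition induced_on :: "'a set \<Rightarrow> 'a set set \<Rightarrow> 'a sgraph" where
  "induced_on U E = (U, {e \<in> E. e \<subseteq> U})"

definition has_induced_mono ::
    "nat \<Rightarrow> nat set set \<Rightarrow> nat set set \<Rightarrow> 'a sgraph \<Rightarrow> bool" where
  "has_induced_mono n R B H \<longleftrightarrow>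
     (\<exists>U \<subseteq> {..<n}. card U = card (verts H) \<and>
        (sgraph_iso (induced_on U R) H \<or> sgraph_iso (induced_on U B) H))"

definition avoiding_sizes :: "nat \<Rightarrow> 'a sgraph set \<Rightarrow> nat set" where
  "avoiding_sizes n F =
     {m. \<exists>R B. two_edge_coloring n R B \<and> m = min (card R) (card B) \<and>
               (\<forall>H\<in>F. \<not> has_induced_mono n R B H)}"

text \<open>
  The smaller colour class never has more than \<open>(n choose 2) div 2\<close> edges, so the bound
  \<open>m \<le> (n choose 2) / 2\<close> holds for every avoiding size.  If the extreme value
  \<open>(n choose 2) div 2\<close> is attained by an avoiding colouring, then a bound on the smaller
  colour class that forces a member of \<open>F\<close> could only hold vacuously; this is the case in
  which the extremal number is \<open>\<infinity>\<close>.  For families without complete or empty graphs the set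
  of avoiding sizes contains \<open>0\<close>, and the supremum is then a maximum.
\<close>

definition ex2 :: "nat \<Rightarrow> 'a sgraph set \<Rightarrow> enat" where
  "ex2 n F =
     (if (n choose 2) div 2 \<in> avoiding_sizes n F then \<infinity>
      else Sup (enat ` avoiding_sizes n F))"

lemma avoiding_sizes_le:
  assumes "m \<in> avoiding_sizes n F"
  shows "2 * m \<le> n choose 2"
proof -
  obtain R B where c: "two_edge_coloring n R B" "m = min (card R) (card B)"
    using assms by (auto simp: avoiding_sizes_def)
  have "finite (all_edges {..<n})"
    by (rule finite_subset[of _ "Pow {..<n}"]) (auto simp: all_edges_def)
  hence "card R + card B = card (all_edges {..<n})"
    using c(1) card_Un_disjoint[of R B]
    by (metis finite_Un two_edge_coloring_def)
  also have "\<dots> = n choose 2"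
    unfolding all_edges_def by (simp add: n_subsets)
  finally show ?thesis using c(2) by linarith
qed

text \<open>The second description of the extremal number, as a least forcing bound.\<close>

lemma ex2_le_iff:
  assumes "m < (n choose 2) div 2"
  shows "ex2 n F \<le> enat m \<longleftrightarrow>
    (\<forall>R B. two_edge_coloring n R B \<and> m < card R \<and> m < card B \<longrightarrow>
           (\<exists>H\<in>F. has_induced_mono n R B H))"
    (is "_ \<longleftrightarrow> ?forces")
proof -
  have forces: "?forces \<longleftrightarrow> (\<forall>k\<in>avoiding_sizes n F. k \<le> m)"
  proof
    assume f: ?forces
    show "\<forall>k\<in>avoiding_sizes n F. k \<le> m"
    proof
      fix k assume "k \<in> avoiding_sizes n F"
      then obtain R B where "two_edge_coloring n R B" "k = min (card R) (card B)"
        "\<forall>H\<in>F. \<not> has_induced_mono n R B H"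
        by (auto simp: avoiding_sizes_def)
      with f show "k \<le> m" by (meson min_less_iff_conj not_le)
    qed
  next
    assume k: "\<forall>k\<in>avoiding_sizes n F. k \<le> m"
    show ?forces
    proof (intro allI impI, rule ccontr)
      fix R B assume c: "two_edge_coloring n R B \<and> m < card R \<and> m < card B"
        and "\<not> (\<exists>H\<in>F. has_induced_mono n R B H)"
      hence "min (card R) (card B) \<in> avoiding_sizes n F"
        unfolding avoiding_sizes_def by blast
      with k have "min (card R) (card B) \<le> m" by blast
      with c show False by (auto simp: min_def split: if_splits)
    qed
  qed
  show ?thesis
  proof (cases "(n choose 2) div 2 \<in> avoiding_sizes n F")
    case True
    then show ?thesis using assms forces by (auto simp: ex2_def not_le)
  next
    case False
    then show ?thesis by (simp add: ex2_def forces Sup_le_iff)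
  qed
qed

end

theory Submission
  imports
    Defs
    "HOL-Library.Function_Algebras"
    "HOL-Library.Ramsey"
    "HOL-Library.Z2"
    "HOL-Algebra.Algebraic_Closure_Type"
    "HOL-Real_Asymp.Real_Asymp"
begin

text \<open>
  Upper bound. A large red clique and a large blue clique together contain, by Ramsey's theorem
  applied between them, an induced monochromatic \<open>S\<^bsub>t,t\<^esub>\<close>. So one colour, say red, has no large
  clique, and then a fixed proportion of the \<open>s\<close>-subsets of every large red neighbourhood is blue.
  With more than \<open>C n powr (2 - 1/s)\<close> red edges, double counting as for
  Kovari, Sos and Turan gives a blue \<open>s\<close>-set with many common red neighbours, among which there
  is a blue \<open>t\<close>-set.

  Lower bound. Red is the bipartite double cover of a projective norm graph over \<open>GF(2\<^sup>m)\<close>; it has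
  no \<open>K\<^bsub>s,t\<^esub>\<close>, and an induced blue copy would contain a red triangle. Counting common neighbours
  amounts to the bound of Kollar, Ronyai and Szabo: a system \<open>\<Prod>\<^sub>j (x\<^sub>j - a\<^sub>i\<^sub>j) = b\<^sub>i\<close> with
  \<open>i, j < t\<close>, and \<open>a\<^sub>i\<^sub>j \<noteq> a\<^sub>l\<^sub>j\<close> for \<open>i \<noteq> l\<close>, has at most \<open>t!\<close> solutions. Let \<open>U\<close> be the space
  of the polynomials with \<open>deg x\<^sub>j \<le> j\<close>, of dimension \<open>t!\<close>, and \<open>W\<close> the one of those with
  \<open>deg x\<^sub>j \<le> j + 1\<close>. Interpolation shows \<open>W = U + (\<Sum>i. f\<^sub>i U)\<close> for the left-hand sides \<open>f\<^sub>i\<close>, so that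
  on the solution set every element of \<open>W\<close> agrees with one of \<open>U\<close>. Hence \<open>U\<close> restricted to the
  solutions is closed under multiplication by the variables, and consists of all functions.
\<close>

section \<open>Systems of product equations\<close>

text \<open>The polynomial functions of \<open>x\<^sub>0, \<dots>, x\<^sub>t\<^sub>-\<^sub>1\<close> whose degree in \<open>x\<^sub>j\<close> is at most \<open>j + k\<close>.\<close>

primrec stair_polys :: "nat \<Rightarrow> nat \<Rightarrow> ((nat \<Rightarrow> 'a::field) \<Rightarrow> 'a) set" where
  "stair_polys k 0 = range (\<lambda>c x. c)"
| "stair_polys k (Suc t) =
     {\<lambda>x. \<Sum>e\<le>t + k. h e x * x t ^ e | h. \<forall>e. h e \<in> stair_polys k t}"

section \<open>Closure properties of the spaces \<open>stair_polys k t\<close>\<close>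

lemma stair_polys_SucI:
  assumes "\<And>e. h e \<in> stair_polys k t" "\<And>x. f x = (\<Sum>e\<le>t + k. h e x * x t ^ e)"
  shows "f \<in> stair_polys k (Suc t)"
proof -
  have "f = (\<lambda>x. \<Sum>e\<le>t + k. h e x * x t ^ e)"
    using assms(2) by blast
  then show ?thesis
    using assms(1) by (auto simp: stair_polys.simps(2))
qed

lemma stair_polys_SucE:
  assumes "f \<in> stair_polys k (Suc t)"
  obtains h where "\<And>e. h e \<in> stair_polys k t" "f = (\<lambda>x. \<Sum>e\<le>t + k. h e x * x t ^ e)"
  using assms by (auto simp: stair_polys.simps(2))

declare stair_polys.simps(2) [simp del]

text \<open>Elements are functions of whole sequences in which only the coordinates below
  \<open>t\<close> enter; hence coordinate \<open>t\<close> can be set freely when a node is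
  extended.\<close>

lemma stair_polys_local:
  assumes "f \<in> stair_polys k t" "\<And>j. j < t \<Longrightarrow> x j = y j"
  shows "f x = f y"
  using assms
proof (induction t arbitrary: f)
  case (Suc t)
  obtain h where h: "\<And>e. h e \<in> stair_polys k t" "f = (\<lambda>x. \<Sum>e\<le>t + k. h e x * x t ^ e)"
    using Suc.prems(1) by (rule stair_polys_SucE) (rule that)
  have "h e x = h e y" for e
    using Suc.IH[OF h(1)] Suc.prems(2) by simp
  then show ?case
    using Suc.prems(2) by (simp add: h(2))
qed auto

lemma stair_polys_const: "(\<lambda>x. c) \<in> stair_polys k t"
proof (induction t arbitrary: c)
  case (Suc t)
  show ?case
    by (rule stair_polys_SucI[where h = "\<lambda>e x. if e = 0 then c else 0"])
       (auto simp: Suc if_distrib[of "\<lambda>u. u * _"] cong: if_cong)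
qed auto

text \<open>Pads a coefficient family with zeros where the degree bound in the last variable rises
  from \<open>t\<close> to \<open>t + 1\<close>.\<close>

lemma stair_polys_if:
  "f \<in> stair_polys k t \<Longrightarrow> (\<lambda>x. if P then f x else 0) \<in> stair_polys k t"
  by (cases P) (simp_all add: stair_polys_const)

lemma stair_polys_add:
  assumes "f \<in> stair_polys k t" "g \<in> stair_polys k t"
  shows "(\<lambda>x. f x + g x) \<in> stair_polys k t"
  using assms
proof (induction t arbitrary: f g)
  case (Suc t)
  obtain h where h: "\<And>e. h e \<in> stair_polys k t" "f = (\<lambda>x. \<Sum>e\<le>t + k. h e x * x t ^ e)"
    using Suc.prems(1) by (rule stair_polys_SucE) (rule that)
  obtain h' where h': "\<And>e. h' e \<in> stair_polys k t" "g = (\<lambda>x. \<Sum>e\<le>t + k. h' e x * x t ^ e)"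
    using Suc.prems(2) by (rule stair_polys_SucE) (rule that)
  show ?case
    by (rule stair_polys_SucI[where h = "\<lambda>e x. h e x + h' e x"])
       (auto simp: h(1) h'(1) Suc.IH h(2) h'(2) sum.distrib distrib_right)
qed auto

lemma stair_polys_scale:
  assumes "f \<in> stair_polys k t"
  shows "(\<lambda>x. c * f x) \<in> stair_polys k t"
  using assms
proof (induction t arbitrary: f)
  case (Suc t)
  obtain h where h: "\<And>e. h e \<in> stair_polys k t" "f = (\<lambda>x. \<Sum>e\<le>t + k. h e x * x t ^ e)"
    using Suc.prems by (rule stair_polys_SucE) (rule that)
  show ?case
    by (rule stair_polys_SucI[where h = "\<lambda>e x. c * h e x"])
       (auto simp: h(1) Suc.IH h(2) sum_distrib_left mult.assoc)
qed auto

lemma stair_polys_diff: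
  assumes "f \<in> stair_polys k t" "g \<in> stair_polys k t"
  shows "(\<lambda>x. f x - g x) \<in> stair_polys k t"
  using stair_polys_add[OF assms(1) stair_polys_scale[OF assms(2), of "-1"]] by simp

lemma stair_polys_sum:
  assumes "\<And>i. i \<in> A \<Longrightarrow> f i \<in> stair_polys k t"
  shows "(\<lambda>x. \<Sum>i\<in>A. f i x) \<in> stair_polys k t"
  using assms
  by (induction A rule: infinite_finite_induct) (auto intro: stair_polys_const stair_polys_add)

lemma stair_polys_mono:
  assumes "f \<in> stair_polys 0 t"
  shows "f \<in> stair_polys 1 t"
  using assms
proof (induction t arbitrary: f)
  case (Suc t)
  obtain h where h: "\<And>e. h e \<in> stair_polys 0 t" "f = (\<lambda>x. \<Sum>e\<le>t + 0. h e x * x t ^ e)"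
    using Suc.prems by (rule stair_polys_SucE) (rule that)
  show ?case
    by (rule stair_polys_SucI[where h = "\<lambda>e x. if e \<le> t then h e x else 0"])
       (simp_all only: h Suc.IH stair_polys_if, simp)
qed auto

text \<open>The coefficients may already have spent the extra degree in the earlier variables, while
  the sum stops one power short of the bound \<open>t + 1\<close> for the last one. This leaves room
  for one linear factor in \<open>x t\<close>.\<close>

lemma stair_polys_Suc_times_linear:
  assumes "\<And>e. h e \<in> stair_polys 1 t"
  shows "(\<lambda>x. (\<Sum>e\<le>t. h e x * x t ^ e) * (x t - c)) \<in> stair_polys 1 (Suc t)"
proof -
  have "(\<lambda>x. (\<Sum>e\<le>t. h e x * x t ^ e) * x t) \<in> stair_polys 1 (Suc t)"
  proof (rule stair_polys_SucI[where h = "\<lambda>e. case e of 0 \<Rightarrow> (\<lambda>x. 0) | Suc e \<Rightarrow> h e"])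
    show "(case e of 0 \<Rightarrow> (\<lambda>x. 0) | Suc e \<Rightarrow> h e) \<in> stair_polys 1 t" for e
      by (cases e) (simp_all add: assms[unfolded One_nat_def] stair_polys_const)
    show "(\<Sum>e\<le>t. h e x * x t ^ e) * x t =
        (\<Sum>e\<le>t + 1. (case e of 0 \<Rightarrow> (\<lambda>x. 0) | Suc e \<Rightarrow> h e) x * x t ^ e)" for x
      unfolding Suc_eq_plus1[symmetric]
      by (subst sum.atMost_Suc_shift) (simp add: sum_distrib_left mult_ac)
  qed
  moreover have "(\<lambda>x. \<Sum>e\<le>t. h e x * x t ^ e) \<in> stair_polys 1 (Suc t)"
    by (rule stair_polys_SucI[where h = "\<lambda>e x. if e \<le> t then h e x else 0"])
       (simp_all only: assms stair_polys_if, simp)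
  then have "(\<lambda>x. c * (\<Sum>e\<le>t. h e x * x t ^ e)) \<in> stair_polys 1 (Suc t)"
    by (rule stair_polys_scale)
  ultimately have "(\<lambda>x. (\<Sum>e\<le>t. h e x * x t ^ e) * x t - c * (\<Sum>e\<le>t. h e x * x t ^ e))
      \<in> stair_polys 1 (Suc t)"
    by (rule stair_polys_diff)
  then show ?thesis
    by (simp only: right_diff_distrib mult.commute[of c])
qed

text \<open>For the last variable the powers are shifted by one; for an earlier variable the factor
  moves into the coefficients.\<close>

lemma stair_polys_times_var:
  assumes "f \<in> stair_polys 0 t" "j < t"
  shows "(\<lambda>x. x j * f x) \<in> stair_polys 1 t"
  using assms
proof (induction t arbitrary: f)
  case (Suc t)
  obtain h where h: "\<And>e. h e \<in> stair_polys 0 t" "f = (\<lambda>x. \<Sum>e\<le>t + 0. h e x * x t ^ e)"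
    using Suc.prems(1) by (rule stair_polys_SucE) (rule that)
  show ?case
  proof (cases "j = t")
    case True
    have "(\<lambda>x. (\<Sum>e\<le>t. h e x * x t ^ e) * (x t - 0)) \<in> stair_polys 1 (Suc t)"
      by (rule stair_polys_Suc_times_linear) (rule stair_polys_mono[OF h(1)])
    with True show ?thesis
      by (simp add: h(2) mult.commute)
  next
    case False
    with Suc.prems(2) have "(\<lambda>x. x j * h e x) \<in> stair_polys 1 t" for e
      using Suc.IH[OF h(1)] by simp
    then show ?thesis
      by (intro stair_polys_SucI[where h = "\<lambda>e x. if e \<le> t then x j * h e x else 0"])
         (simp_all only: h(2) stair_polys_if, simp add: sum_distrib_left mult.assoc)
  qed
qed auto

text \<open>Each variable occurs once in the product, so every degree bound rises by one. The
  induction hands the earlier factors to the coefficients and keeps the last one for the outer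
  sum.\<close>

lemma stair_polys_times_product:
  assumes "f \<in> stair_polys 0 t"
  shows "(\<lambda>x. f x * (\<Prod>j<t. x j - a j)) \<in> stair_polys 1 t"
  using assms
proof (induction t arbitrary: f)
  case (Suc t)
  obtain h where h: "\<And>e. h e \<in> stair_polys 0 t" "f = (\<lambda>x. \<Sum>e\<le>t + 0. h e x * x t ^ e)"
    using Suc.prems by (rule stair_polys_SucE) (rule that)
  have "(\<lambda>x. (\<Sum>e\<le>t. (h e x * (\<Prod>j<t. x j - a j)) * x t ^ e) * (x t - a t))
      \<in> stair_polys 1 (Suc t)"
    by (rule stair_polys_Suc_times_linear) (rule Suc.IH[OF h(1)])
  then show ?case
    by (simp add: h(2) sum_distrib_right sum_distrib_left mult_ac)
qed auto

section \<open>Interpolation at the nodes given by injections\<close>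

lemma poly_coeffs_eq_0:
  fixes c :: "nat \<Rightarrow> 'a::idom"
  assumes "finite A" "card A > d" "\<And>z. z \<in> A \<Longrightarrow> (\<Sum>e\<le>d. c e * z ^ e) = 0" "e \<le> d"
  shows "c e = 0"
proof (rule ccontr)
  assume "c e \<noteq> 0"
  let ?p = "\<Sum>e\<le>d. Polynomial.monom (c e) e"
  have ev: "poly ?p z = (\<Sum>e\<le>d. c e * z ^ e)" for z
    by (simp add: poly_sum Polynomial.poly_monom)
  have "poly.coeff ?p e = c e"
    using assms(4) by (simp add: coeff_sum)
  with \<open>c e \<noteq> 0\<close> have nz: "?p \<noteq> 0"
    by auto
  have "card A \<le> card {z. poly ?p z = 0}"
    by (intro card_mono poly_roots_finite nz) (use assms(3) ev in auto)
  also have "\<dots> \<le> Polynomial.degree ?p"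
    by (rule card_poly_roots_bound) (rule nz)
  also have "\<dots> \<le> d"
    by (rule degree_sum_le) (auto intro: order.trans[OF Polynomial.degree_monom_le])
  finally show False
    using assms(2) by simp
qed

text \<open>A node on the rows \<open>C\<close> with last row \<open>c\<close> is a node on the rows
  \<open>C - {c}\<close> with one more coordinate; this is the induction step for the nodes.\<close>

lemma extend_injection:
  assumes "inj_on \<sigma> {..<t}" "\<sigma> ` {..<t} \<subseteq> C - {c}" "c \<in> C"
  shows "inj_on (\<sigma>(t := c)) {..<Suc t}" "(\<sigma>(t := c)) ` {..<Suc t} \<subseteq> C"
proof -
  have c: "c \<notin> \<sigma> ` {..<t}"
    using assms(2) by blast
  have "inj_on (\<sigma>(t := c)) {..<t}"
    using assms(1) c by (rule inj_on_fun_updI)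
  then show "inj_on (\<sigma>(t := c)) {..<Suc t}"
    using c by (simp add: lessThan_Suc fun_upd_image)
  show "(\<sigma>(t := c)) ` {..<Suc t} \<subseteq> C"
    using assms(2,3) by (auto simp: lessThan_Suc fun_upd_image)
qed

text \<open>The nodes are the points with coordinates \<open>a (\<sigma> j) j\<close> for the injections \<open>\<sigma>\<close> into a set of
  \<open>t + k\<close> rows. Fixing \<open>x\<^sub>t\<close> removes one row, so uniqueness and existence go by induction.\<close>

lemma stair_polys_unique:
  assumes "f \<in> stair_polys k t" "finite C" "card C = t + k"
    and "\<And>j. j < t \<Longrightarrow> inj_on (\<lambda>c. a c j) C"
    and "\<And>\<sigma>. inj_on \<sigma> {..<t} \<Longrightarrow> \<sigma> ` {..<t} \<subseteq> C \<Longrightarrow> f (\<lambda>j. a (\<sigma> j) j) = 0"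
  shows "f x = 0"
  using assms
proof (induction t arbitrary: f C x)
  case (Suc t)
  obtain h where h: "\<And>e. h e \<in> stair_polys k t" "f = (\<lambda>x. \<Sum>e\<le>t + k. h e x * x t ^ e)"
    using Suc.prems(1) by (rule stair_polys_SucE) (rule that)
  have zero: "(\<Sum>e\<le>t + k. h e x * (a c t) ^ e) = 0" if c: "c \<in> C" for c
  proof (rule Suc.IH[of "\<lambda>x. \<Sum>e\<le>t + k. h e x * (a c t) ^ e" "C - {c}"])
      show "(\<lambda>x. \<Sum>e\<le>t + k. h e x * (a c t) ^ e) \<in> stair_polys k t"
        by (intro stair_polys_sum) (simp only: mult.commute[of _ "a c t ^ _"] stair_polys_scale[OF h(1)])
      show "finite (C - {c})" "card (C - {c}) = t + k"
        using Suc.prems(2,3) c by auto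
      show "inj_on (\<lambda>c. a c j) (C - {c})" if "j < t" for j
        using Suc.prems(4)[of j] that by (auto intro: inj_on_subset)
      fix \<sigma> assume \<sigma>: "inj_on \<sigma> {..<t}" "\<sigma> ` {..<t} \<subseteq> C - {c}"
      have "f (\<lambda>j. a ((\<sigma>(t := c)) j) j) = 0"
        by (intro Suc.prems(5) extend_injection[OF \<sigma> c])
      moreover have "h e (\<lambda>j. a ((\<sigma>(t := c)) j) j) = h e (\<lambda>j. a (\<sigma> j) j)" for e
        by (rule stair_polys_local[OF h(1)]) simp
      ultimately show "(\<Sum>e\<le>t + k. h e (\<lambda>j. a (\<sigma> j) j) * (a c t) ^ e) = 0"
        by (simp add: h(2))
  qed
  \<comment> \<open>For fixed \<open>x\<close> the \<open>h e x\<close> are the coefficients of a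
    polynomial of degree at most \<open>t + k\<close> that vanishes at the \<open>t + k + 1\<close>
    distinct values \<open>a c t\<close>.\<close>
  have "h e x = 0" if "e \<le> t + k" for e
  proof (rule poly_coeffs_eq_0[OF _ _ _ that])
    show "finite ((\<lambda>c. a c t) ` C)"
      using Suc.prems(2) by simp
    show "t + k < card ((\<lambda>c. a c t) ` C)"
      using Suc.prems(3) Suc.prems(4)[of t] by (simp add: card_image)
  qed (use zero in auto)
  then show ?case
    by (simp add: h(2))
qed auto

lemma lagrange_basis:
  fixes A :: "'a::field set"
  assumes "finite A" "c \<in> A"
  shows "\<exists>p. Polynomial.degree p < card A \<and> poly p c = 1 \<and> (\<forall>z\<in>A - {c}. poly p z = 0)"
proof (intro exI conjI ballI)
  let ?p = "\<Prod>z\<in>A - {c}. Polynomial.smult (1 / (c - z)) [:-z, 1:]"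
  have "Polynomial.degree ?p \<le>
      sum (Polynomial.degree \<circ> (\<lambda>z. Polynomial.smult (1 / (c - z)) [:-z, 1:])) (A - {c})"
    by (rule degree_prod_sum_le) (use assms in auto)
  also have "\<dots> \<le> (\<Sum>z\<in>A - {c}. 1)"
    by (intro sum_mono) simp
  also have "\<dots> < card A"
    using assms card_Diff1_less[OF assms] by simp
  finally show "Polynomial.degree ?p < card A" .
  show "poly ?p c = 1"
    unfolding poly_prod by (rule prod.neutral) (auto simp: divide_simps)
  show "poly ?p z = 0" if "z \<in> A - {c}" for z
    unfolding poly_prod by (rule prod_zero) (use assms that in auto)
qed

text \<open>Injections that agree below \<open>t\<close> give the same node; reading them through
  \<open>restrict\<close> prescribes one value per node.\<close>

lemma stair_polys_interpolate:
  assumes "finite C" "card C = t + k"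
    and "\<And>j. j < t \<Longrightarrow> inj_on (\<lambda>c. a c j) C"
  shows "\<exists>f\<in>stair_polys k t. \<forall>\<sigma>. inj_on \<sigma> {..<t} \<longrightarrow> \<sigma> ` {..<t} \<subseteq> C \<longrightarrow>
           f (\<lambda>j. a (\<sigma> j) j) = v (restrict \<sigma> {..<t})"
  using assms
proof (induction t arbitrary: C v)
  case 0
  \<comment> \<open>\<open>restrict \<sigma> {..<0}\<close> is constantly \<open>undefined\<close>,
    so there is only one value to match.\<close>
  show ?case
    by (rule bexI[of _ "\<lambda>x. v (\<lambda>i. undefined)"]) (simp_all add: restrict_def)
next
  case (Suc t)
  have "\<forall>c\<in>C. \<exists>f\<in>stair_polys k t. \<forall>\<sigma>. inj_on \<sigma> {..<t} \<longrightarrow> \<sigma> ` {..<t} \<subseteq> C - {c} \<longrightarrow>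
           f (\<lambda>j. a (\<sigma> j) j) = v ((restrict \<sigma> {..<t})(t := c))"
  proof
    fix c assume c: "c \<in> C"
    have "\<And>j. j < t \<Longrightarrow> inj_on (\<lambda>c. a c j) (C - {c})"
      using Suc.prems(3) by (meson Diff_subset inj_on_subset less_SucI)
    then show "\<exists>f\<in>stair_polys k t. \<forall>\<sigma>. inj_on \<sigma> {..<t} \<longrightarrow> \<sigma> ` {..<t} \<subseteq> C - {c} \<longrightarrow>
           f (\<lambda>j. a (\<sigma> j) j) = v ((restrict \<sigma> {..<t})(t := c))"
      by (intro Suc.IH[of "C - {c}" "\<lambda>\<tau>. v (\<tau>(t := c))"]) (use Suc.prems(1,2) c in auto)
  qed
  then obtain h where "\<forall>c\<in>C. h c \<in> stair_polys k t \<and> (\<forall>\<sigma>. inj_on \<sigma> {..<t} \<longrightarrow> \<sigma> ` {..<t} \<subseteq> C - {c} \<longrightarrow>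
           h c (\<lambda>j. a (\<sigma> j) j) = v ((restrict \<sigma> {..<t})(t := c)))"
    unfolding Bex_def by (rule bchoice[THEN exE])
  then have h: "\<And>c. c \<in> C \<Longrightarrow> h c \<in> stair_polys k t"
    and hv: "\<And>c \<sigma>. c \<in> C \<Longrightarrow> inj_on \<sigma> {..<t} \<Longrightarrow> \<sigma> ` {..<t} \<subseteq> C - {c} \<Longrightarrow>
           h c (\<lambda>j. a (\<sigma> j) j) = v ((restrict \<sigma> {..<t})(t := c))"
    by blast+
  have inj: "inj_on (\<lambda>c. a c t) C"
    using Suc.prems(3) by simp
  have "\<forall>c\<in>C. \<exists>p. Polynomial.degree p < card C \<and> poly p (a c t) = 1 \<and>
      (\<forall>c'\<in>C - {c}. poly p (a c' t) = 0)"
  proof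
    fix c assume c: "c \<in> C"
    obtain p where p: "Polynomial.degree p < card ((\<lambda>c. a c t) ` C)" "poly p (a c t) = 1"
        "\<forall>z\<in>(\<lambda>c. a c t) ` C - {a c t}. poly p z = 0"
      using lagrange_basis[of "(\<lambda>c. a c t) ` C" "a c t"] Suc.prems(1) c by blast
    moreover have "a c' t \<in> (\<lambda>c. a c t) ` C - {a c t}" if "c' \<in> C - {c}" for c'
      using inj c that by (auto dest: inj_onD)
    ultimately show "\<exists>p. Polynomial.degree p < card C \<and> poly p (a c t) = 1 \<and>
      (\<forall>c'\<in>C - {c}. poly p (a c' t) = 0)"
      using inj by (metis card_image)
  qed
  then obtain L where "\<forall>c\<in>C. Polynomial.degree (L c) < card C \<and> poly (L c) (a c t) = 1 \<and>
      (\<forall>c'\<in>C - {c}. poly (L c) (a c' t) = 0)"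
    by (rule bchoice[THEN exE])
  then have L: "\<And>c. c \<in> C \<Longrightarrow> Polynomial.degree (L c) < card C"
      "\<And>c. c \<in> C \<Longrightarrow> poly (L c) (a c t) = 1"
      "\<And>c c'. c \<in> C \<Longrightarrow> c' \<in> C - {c} \<Longrightarrow> poly (L c) (a c' t) = 0"
    by blast+
  \<comment> \<open>Lagrange interpolation in the last variable: at a node only the summand of its
    last row \<open>c\<close> survives, and \<open>h c\<close> interpolates on the remaining
    rows.\<close>
  define f where "f = (\<lambda>x. \<Sum>c\<in>C. poly (L c) (x t) * h c x)"
  have Lsum: "poly (L c) z = (\<Sum>e\<le>t + k. poly.coeff (L c) e * z ^ e)" if "c \<in> C" for c z
  proof -
    have "Polynomial.degree (L c) \<le> t + k"
      using L(1)[OF that] Suc.prems(2) by simp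
    then show ?thesis
      unfolding poly_altdef by (intro sum.mono_neutral_left) (auto simp: coeff_eq_0)
  qed
  have "f \<in> stair_polys k (Suc t)"
  proof (rule stair_polys_SucI[where h = "\<lambda>e x. \<Sum>c\<in>C. poly.coeff (L c) e * h c x"])
    show "(\<lambda>x. \<Sum>c\<in>C. poly.coeff (L c) e * h c x) \<in> stair_polys k t" for e
      by (intro stair_polys_sum stair_polys_scale h)
    have "f x = (\<Sum>c\<in>C. \<Sum>e\<le>t + k. poly.coeff (L c) e * h c x * x t ^ e)" for x
      unfolding f_def by (intro sum.cong refl) (simp add: Lsum sum_distrib_left mult_ac)
    then show "f x = (\<Sum>e\<le>t + k. (\<Sum>c\<in>C. poly.coeff (L c) e * h c x) * x t ^ e)" for x
      unfolding sum_distrib_right by (subst sum.swap) simp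
  qed
  moreover have "f (\<lambda>j. a (\<sigma> j) j) = v (restrict \<sigma> {..<Suc t})"
    if \<sigma>: "inj_on \<sigma> {..<Suc t}" "\<sigma> ` {..<Suc t} \<subseteq> C" for \<sigma>
  proof -
    have c: "\<sigma> t \<in> C"
      using \<sigma>(2) by auto
    have "f (\<lambda>j. a (\<sigma> j) j) = (\<Sum>c\<in>{\<sigma> t}. poly (L c) (a (\<sigma> t) t) * h c (\<lambda>j. a (\<sigma> j) j))"
      unfolding f_def
      by (rule sum.mono_neutral_right) (use Suc.prems(1) c L(3) in auto)
    also have "\<dots> = h (\<sigma> t) (\<lambda>j. a (\<sigma> j) j)"
      using L(2) c by simp
    also have "\<dots> = v ((restrict \<sigma> {..<t})(t := \<sigma> t))"
    proof (rule hv[OF c])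
      show "inj_on \<sigma> {..<t}"
        using \<sigma>(1) by (rule inj_on_subset) auto
      show "\<sigma> ` {..<t} \<subseteq> C - {\<sigma> t}"
      proof (rule image_subsetI)
        fix i assume "i \<in> {..<t}"
        then have "i < t" by simp
        then have "\<sigma> i \<noteq> \<sigma> t"
          using inj_onD[OF \<sigma>(1), of i t] by auto
        then show "\<sigma> i \<in> C - {\<sigma> t}"
          using \<sigma>(2) \<open>i < t\<close> by auto
      qed
    qed
    also have "(restrict \<sigma> {..<t})(t := \<sigma> t) = restrict \<sigma> {..<Suc t}"
      by (auto simp: fun_eq_iff restrict_def)
    finally show ?thesis .
  qed
  ultimately show ?case
    by blast
qed

text \<open>Add a row of fresh values to \<open>a\<close>. An injection of the \<open>t\<close> columns into the \<open>t + 1\<close> rows omits one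
  row: if it is the new one, all products vanish there and \<open>g\<close> is prescribed; if it is row \<open>i\<close>, only
  the \<open>i\<close>-th product is nonzero, which prescribes \<open>h i\<close>.\<close>

lemma stair_polys_1_representation:
  fixes a :: "nat \<Rightarrow> nat \<Rightarrow> 'a::field"
  assumes "infinite (UNIV :: 'a set)"
    and "\<And>i i' j. i < t \<Longrightarrow> i' < t \<Longrightarrow> j < t \<Longrightarrow> i \<noteq> i' \<Longrightarrow> a i j \<noteq> a i' j"
    and "f \<in> stair_polys 1 t"
  shows "\<exists>g h. g \<in> stair_polys 0 t \<and> (\<forall>i<t. h i \<in> stair_polys 0 t) \<and>
           (\<forall>x. f x = g x + (\<Sum>i<t. h i x * (\<Prod>j<t. x j - a i j)))"
proof -
  have "\<forall>j. \<exists>z. z \<notin> (\<lambda>i. a i j) ` {..<t}"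
    using ex_new_if_finite[OF assms(1)] by blast
  then obtain z where z: "\<And>j. z j \<notin> (\<lambda>i. a i j) ` {..<t}"
    by metis
  define b where "b = (\<lambda>i j. if i = t then z j else a i j)"
  have inj: "inj_on (\<lambda>i. b i j) {..t}" if "j < t" for j
  proof (rule inj_onI, rule ccontr)
    fix i i' assume i: "i \<in> {..t}" "i' \<in> {..t}" "b i j = b i' j" "i \<noteq> i'"
    have z': "z j \<noteq> a l j" if "l < t" for l
      using z[of j] that by blast
    then show False
      using i assms(2)[of i i' j] that z' z'[THEN not_sym] by (auto simp: b_def le_less split: if_splits)
  qed
  have b_eq: "b i j = a i j" if "i < t" for i j
    using that by (simp add: b_def)
  have interp: "\<exists>g\<in>stair_polys 0 t. \<forall>\<sigma>. inj_on \<sigma> {..<t} \<longrightarrow> \<sigma> ` {..<t} \<subseteq> {..t} - {m} \<longrightarrow>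
           g (\<lambda>j. b (\<sigma> j) j) = v (restrict \<sigma> {..<t})" if "m \<le> t" for m v
    using that inj by (intro stair_polys_interpolate) (auto intro: inj_on_subset)
  have restrict: "f (\<lambda>j. b (restrict \<sigma> {..<t} j) j) = f (\<lambda>j. b (\<sigma> j) j)"
    if "f \<in> stair_polys k t" for f \<sigma> k
    using that by (rule stair_polys_local) simp
  define P where "P = (\<lambda>i x. \<Prod>j<t. x j - a i j)"
  have P_restrict: "P i (\<lambda>j. b (restrict \<sigma> {..<t} j) j) = P i (\<lambda>j. b (\<sigma> j) j)" for i \<sigma>
    by (simp add: P_def)
  obtain g where g: "g \<in> stair_polys 0 t" and
    "\<forall>\<sigma>. inj_on \<sigma> {..<t} \<longrightarrow> \<sigma> ` {..<t} \<subseteq> {..t} - {t} \<longrightarrow>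
      g (\<lambda>j. b (\<sigma> j) j) = f (\<lambda>j. b (restrict \<sigma> {..<t} j) j)"
    using interp[of t "\<lambda>\<sigma>. f (\<lambda>j. b (\<sigma> j) j)"] by auto
  then have g_eq: "g (\<lambda>j. b (\<sigma> j) j) = f (\<lambda>j. b (\<sigma> j) j)"
    if "inj_on \<sigma> {..<t}" "\<sigma> ` {..<t} \<subseteq> {..t} - {t}" for \<sigma>
    using that restrict[OF assms(3)] by simp
  have "\<forall>i\<in>{..<t}. \<exists>h\<in>stair_polys 0 t. \<forall>\<sigma>. inj_on \<sigma> {..<t} \<longrightarrow> \<sigma> ` {..<t} \<subseteq> {..t} - {i} \<longrightarrow>
      h (\<lambda>j. b (\<sigma> j) j) = (f (\<lambda>j. b (\<sigma> j) j) - g (\<lambda>j. b (\<sigma> j) j)) / P i (\<lambda>j. b (\<sigma> j) j)"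
  proof
    fix i assume "i \<in> {..<t}"
    then show "\<exists>h\<in>stair_polys 0 t. \<forall>\<sigma>. inj_on \<sigma> {..<t} \<longrightarrow> \<sigma> ` {..<t} \<subseteq> {..t} - {i} \<longrightarrow>
      h (\<lambda>j. b (\<sigma> j) j) = (f (\<lambda>j. b (\<sigma> j) j) - g (\<lambda>j. b (\<sigma> j) j)) / P i (\<lambda>j. b (\<sigma> j) j)"
      using interp[of i "\<lambda>\<sigma>. (f (\<lambda>j. b (\<sigma> j) j) - g (\<lambda>j. b (\<sigma> j) j)) / P i (\<lambda>j. b (\<sigma> j) j)"]
      by (simp only: restrict[OF assms(3)] restrict[OF g] P_restrict) simp
  qed
  then obtain h where "\<forall>i\<in>{..<t}. h i \<in> stair_polys 0 t \<and> (\<forall>\<sigma>. inj_on \<sigma> {..<t} \<longrightarrow> \<sigma> ` {..<t} \<subseteq> {..t} - {i} \<longrightarrow>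
      h i (\<lambda>j. b (\<sigma> j) j) = (f (\<lambda>j. b (\<sigma> j) j) - g (\<lambda>j. b (\<sigma> j) j)) / P i (\<lambda>j. b (\<sigma> j) j))"
    unfolding Bex_def by (rule bchoice[THEN exE])
  then have h: "\<And>i. i < t \<Longrightarrow> h i \<in> stair_polys 0 t"
    and h_eq: "\<And>i \<sigma>. i < t \<Longrightarrow> inj_on \<sigma> {..<t} \<Longrightarrow> \<sigma> ` {..<t} \<subseteq> {..t} - {i} \<Longrightarrow>
      h i (\<lambda>j. b (\<sigma> j) j) = (f (\<lambda>j. b (\<sigma> j) j) - g (\<lambda>j. b (\<sigma> j) j)) / P i (\<lambda>j. b (\<sigma> j) j)"
    by (blast dest: lessThan_iff[THEN iffD2])+
  \<comment> \<open>The defect \<open>w\<close> lies in \<open>stair_polys 1 t\<close> and vanishes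
    at every node on the \<open>t + 1\<close> rows, hence everywhere by uniqueness.\<close>
  define w where "w = (\<lambda>x. f x - (g x + (\<Sum>i<t. h i x * P i x)))"
  have w: "w \<in> stair_polys 1 t"
    unfolding w_def P_def using h
    by (intro stair_polys_diff assms(3) stair_polys_add stair_polys_sum stair_polys_times_product
        stair_polys_mono g) auto
  have "w x = 0" for x
  proof (rule stair_polys_unique[OF w, of "{..t}" b])
    fix \<sigma> assume \<sigma>: "inj_on \<sigma> {..<t}" "\<sigma> ` {..<t} \<subseteq> {..t}"
    let ?x = "\<lambda>j. b (\<sigma> j) j"
    have "card ({..t} - \<sigma> ` {..<t}) = 1"
      using \<sigma> by (simp add: card_Diff_subset card_image)
    then obtain m where m: "{..t} - \<sigma> ` {..<t} = {m}"
      by (rule card_1_singletonE)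
    have P0: "P i ?x = 0" if "i < t" "i \<noteq> m" for i
    proof -
      have "i \<in> \<sigma> ` {..<t}"
        using m that by (metis Diff_iff atMost_iff less_imp_le singletonD)
      then obtain j where "j < t" "\<sigma> j = i"
        by blast
      then show ?thesis
        unfolding P_def using that by (intro prod_zero bexI[of _ j]) (auto simp: b_eq)
    qed
    have sub: "\<sigma> ` {..<t} \<subseteq> {..t} - {m}"
      using m \<sigma>(2) by blast
    show "w ?x = 0"
    proof (cases "m = t")
      case True
      with sub \<sigma>(1) have "g ?x = f ?x"
        by (intro g_eq) auto
      with P0 True show ?thesis
        by (simp add: w_def)
    next
      case False
      then have "m < t"
        using m by (metis Diff_iff atMost_iff le_neq_implies_less singletonI)
      have "P m ?x \<noteq> 0"
      proof -
        have "b (\<sigma> j) j \<noteq> b m j" if "j < t" for j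
        proof -
          have "\<sigma> j \<in> {..t} - {m}"
            using sub that by blast
          then show ?thesis
            using inj_onD[OF inj[OF that], of "\<sigma> j" m] \<open>m < t\<close> by auto
        qed
        then show ?thesis
          using \<open>m < t\<close> by (simp add: P_def b_eq)
      qed
      moreover have "(\<Sum>i<t. h i ?x * P i ?x) = (\<Sum>i\<in>{m}. h i ?x * P i ?x)"
        by (rule sum.mono_neutral_right) (use \<open>m < t\<close> P0 in auto)
      ultimately show ?thesis
        using h_eq[OF \<open>m < t\<close> \<sigma>(1) sub] by (simp add: w_def)
    qed
  qed (use inj in auto)
  then have "\<forall>x. f x = g x + (\<Sum>i<t. h i x * (\<Prod>j<t. x j - a i j))"
    by (simp add: w_def P_def)
  then show ?thesis
    using g h by blast
qed

section \<open>Linear algebra of functions into a field\<close>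

interpretation funspace: vector_space "\<lambda>(c :: 'a::field) f (x :: 'b). c * f x"
  by unfold_locales (auto simp: fun_eq_iff algebra_simps)

text \<open>Together with the minimality of spans, this carries a linear map over a span: only the
  images of generators remain to be checked.\<close>

lemma subspace_preimage:
  assumes "\<And>f g. T (\<lambda>x. f x + g x) = (\<lambda>x. T f x + T g x)"
    and "\<And>c f. T (\<lambda>x. c * f x) = (\<lambda>x. c * T f x)"
  shows "funspace.subspace {f. T f \<in> funspace.span B}"
proof (rule funspace.subspaceI)
  show "0 \<in> {f. T f \<in> funspace.span B}"
    using assms(2)[of 0 "\<lambda>x. 0"] funspace.span_zero[of B] by (simp add: zero_fun_def)
  show "f + g \<in> {f. T f \<in> funspace.span B}"
    if "f \<in> {f. T f \<in> funspace.span B}" "g \<in> {f. T f \<in> funspace.span B}" for f g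
    using that assms(1)[of f g] funspace.span_add[of "T f" B "T g"] by (simp add: plus_fun_def)
  show "(\<lambda>x. c * f x) \<in> {f. T f \<in> funspace.span B}" if "f \<in> {f. T f \<in> funspace.span B}" for c f
    using that assms(2)[of c f] funspace.span_scale[of "T f" B c] by simp
qed

lemma sum_in_funspace_span:
  assumes "\<And>i. i \<in> I \<Longrightarrow> f i \<in> funspace.span B"
  shows "(\<lambda>x. \<Sum>i\<in>I. f i x) \<in> funspace.span B"
proof -
  have "(\<lambda>x. \<Sum>i\<in>I. f i x) = sum f I"
    by (induction I rule: infinite_finite_induct) (auto simp: fun_eq_iff)
  then show ?thesis
    using funspace.span_sum[OF assms] by simp
qed

text \<open>Multiplying a spanning set in \<open>t\<close> variables by the \<open>t + 1\<close>
  powers of \<open>x t\<close> with exponents up to \<open>t\<close> gives one in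
  \<open>t + 1\<close> variables, so the sizes multiply up to a factorial.\<close>

lemma stair_polys_span:
  "\<exists>B. finite B \<and> card B \<le> fact t \<and> (stair_polys 0 t :: ((nat \<Rightarrow> 'a::field) \<Rightarrow> 'a) set) \<subseteq> funspace.span B"
proof (induction t)
  case 0
  have "(\<lambda>x. c) \<in> funspace.span {\<lambda>x :: nat \<Rightarrow> 'a. 1 :: 'a}" for c
    using funspace.span_scale[OF funspace.span_base, of "\<lambda>x. 1" "{\<lambda>x :: nat \<Rightarrow> 'a. 1 :: 'a}" c] by simp
  then show ?case
    by (intro exI[of _ "{\<lambda>x. 1}"]) auto
next
  case (Suc t)
  then obtain B :: "((nat \<Rightarrow> 'a) \<Rightarrow> 'a) set" where B: "finite B" "card B \<le> fact t"
    "stair_polys 0 t \<subseteq> funspace.span B"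
    by blast
  define C where "C = (\<lambda>(e, f) x. f x * x t ^ e) ` ({..t} \<times> B)"
  have "card C \<le> card ({..t} \<times> B)"
    unfolding C_def by (intro card_image_le) (use B(1) in auto)
  also have "\<dots> \<le> fact (Suc t)"
    using mult_le_mono2[OF B(2), of "Suc t"] by (simp add: card_cartesian_product)
  finally have "card C \<le> fact (Suc t)" .
  moreover have "f \<in> funspace.span C" if f: "f \<in> stair_polys 0 (Suc t)" for f
  proof -
    obtain h where h: "\<And>e. h e \<in> stair_polys 0 t" "f = (\<lambda>x. \<Sum>e\<le>t + 0. h e x * x t ^ e)"
      using f by (rule stair_polys_SucE) (rule that)
    have "(\<lambda>x. h e x * x t ^ e) \<in> funspace.span C" if "e \<in> {..t + 0}" for e
    proof -
      have "funspace.span B \<subseteq> {g. (\<lambda>x. g x * x t ^ e) \<in> funspace.span C}"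
      proof (rule funspace.span_minimal)
        show "B \<subseteq> {g. (\<lambda>x. g x * x t ^ e) \<in> funspace.span C}"
          using that by (auto intro!: funspace.span_base simp: C_def)
        show "funspace.subspace {g. (\<lambda>x. g x * x t ^ e) \<in> funspace.span C}"
          by (rule subspace_preimage) (simp_all add: algebra_simps)
      qed
      then show ?thesis
        using h(1) B(3) by blast
    qed
    then show ?thesis
      unfolding h(2) by (rule sum_in_funspace_span)
  qed
  moreover have "finite C"
    using B(1) by (simp add: C_def)
  ultimately show ?case
    by blast
qed

text \<open>Cutting functions off outside \<open>S\<close> is linear and maps the span of
  \<open>B\<close> into the span of at most \<open>card B\<close> functions. The indicators of the
  points of \<open>S\<close> lie there, and they are independent.\<close>

lemma card_le_of_indicators_in_span:
  fixes S :: "'b set" and B :: "('b \<Rightarrow> 'a::field) set"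
  assumes "finite B" "finite S"
    and "\<And>p. p \<in> S \<Longrightarrow> \<exists>g\<in>funspace.span B. \<forall>x\<in>S. g x = (if x = p then 1 else 0)"
  shows "card S \<le> card B"
proof -
  define E where "E = (\<lambda>(f :: 'b \<Rightarrow> 'a) x. if x \<in> S then f x else 0)"
  define \<delta> where "\<delta> = (\<lambda>(p :: 'b) x. if x = p then 1 else 0 :: 'a)"
  have inj: "inj_on \<delta> S"
    by (rule inj_onI) (metis \<delta>_def zero_neq_one)
  have "funspace.independent (\<delta> ` S)"
    unfolding funspace.dependent_def
  proof clarify
    fix p assume p: "p \<in> S" "\<delta> p \<in> funspace.span (\<delta> ` S - {\<delta> p})"
    have "funspace.span (\<delta> ` S - {\<delta> p}) \<subseteq> {f. f p = 0}"
    proof (rule funspace.span_minimal)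
      show "\<delta> ` S - {\<delta> p} \<subseteq> {f. f p = 0}"
        by (auto simp: \<delta>_def)
      show "funspace.subspace {f. f p = 0}"
        by (rule funspace.subspaceI) auto
    qed
    then show False
      using p(2) by (auto simp: \<delta>_def)
  qed
  moreover have "\<delta> ` S \<subseteq> funspace.span (E ` B)"
  proof (rule image_subsetI)
    fix p assume p: "p \<in> S"
    then obtain g where g: "g \<in> funspace.span B" "\<forall>x\<in>S. g x = (if x = p then 1 else 0)"
      using assms(3) by blast
    have "funspace.span B \<subseteq> {f. E f \<in> funspace.span (E ` B)}"
    proof (rule funspace.span_minimal)
      show "B \<subseteq> {f. E f \<in> funspace.span (E ` B)}"
        by (auto intro: funspace.span_base)
      show "funspace.subspace {f. E f \<in> funspace.span (E ` B)}"
        by (rule subspace_preimage) (auto simp: E_def fun_eq_iff)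
    qed
    then have "E g \<in> funspace.span (E ` B)"
      using g(1) by blast
    moreover have "E g = \<delta> p"
      using g(2) p by (auto simp: E_def \<delta>_def fun_eq_iff)
    ultimately show "\<delta> p \<in> funspace.span (E ` B)"
      by simp
  qed
  ultimately have "card (\<delta> ` S) \<le> card (E ` B)"
    using funspace.independent_span_bound[of "E ` B" "\<delta> ` S"] assms(1) by simp
  also have "\<dots> \<le> card B"
    using assms(1) by (rule card_image_le)
  finally show ?thesis
    using inj by (simp add: card_image)
qed

text \<open>On \<open>S\<close> the left-hand sides are constants, which removes the spare degree of
  \<open>stair_polys 1 t\<close>; iterating this puts the indicator of every solution into a space
  of dimension at most \<open>fact t\<close>. Solutions are infinite sequences, so
  \<open>sep\<close> asks that distinct ones differ in a coordinate of the system.\<close>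

theorem card_norm_system_solutions_le:
  fixes a :: "nat \<Rightarrow> nat \<Rightarrow> 'a::field"
  assumes "infinite (UNIV :: 'a set)"
    and "\<And>i i' j. i < t \<Longrightarrow> i' < t \<Longrightarrow> j < t \<Longrightarrow> i \<noteq> i' \<Longrightarrow> a i j \<noteq> a i' j"
    and "finite S"
    and sol: "\<And>x i. x \<in> S \<Longrightarrow> i < t \<Longrightarrow> (\<Prod>j<t. x j - a i j) = b i"
    and sep: "\<And>x y. x \<in> S \<Longrightarrow> y \<in> S \<Longrightarrow> x \<noteq> y \<Longrightarrow> \<exists>j<t. x j \<noteq> y j"
  shows "card S \<le> fact t"
proof -
  define A where "A = (\<lambda>\<phi>. \<exists>g\<in>stair_polys 0 t. \<forall>x\<in>S. \<phi> x = g x)"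
  have A1: "A f" if f: "f \<in> stair_polys 1 t" for f
  proof -
    obtain g h where g: "g \<in> stair_polys 0 t" and h: "\<forall>i<t. h i \<in> stair_polys 0 t"
      and eq: "\<forall>x. f x = g x + (\<Sum>i<t. h i x * (\<Prod>j<t. x j - a i j))"
      using stair_polys_1_representation[where a = a, OF assms(1,2) f] by blast
    have "(\<lambda>x. g x + (\<Sum>i<t. b i * h i x)) \<in> stair_polys 0 t"
      using g h by (intro stair_polys_add stair_polys_sum stair_polys_scale) auto
    moreover have "\<forall>x\<in>S. f x = g x + (\<Sum>i<t. b i * h i x)"
      by (simp add: eq sol mult.commute)
    ultimately show ?thesis
      unfolding A_def by (intro bexI[of _ "\<lambda>x. g x + (\<Sum>i<t. b i * h i x)"])
  qed
  \<comment> \<open>A linear factor leads into \<open>stair_polys 1 t\<close>, and \<open>A1\<close>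
    leads back to \<open>stair_polys 0 t\<close> on \<open>S\<close>.\<close>
  have A_step: "A (\<lambda>x. d * (x j - c) * \<phi> x)" if \<phi>: "A \<phi>" "j < t" for \<phi> j c d
  proof -
    obtain g where g: "g \<in> stair_polys 0 t" "\<forall>x\<in>S. \<phi> x = g x"
      using \<phi>(1) unfolding A_def by blast
    have "A (\<lambda>x. d * (x j * g x) - (d * c) * g x)"
      by (intro A1 stair_polys_diff stair_polys_scale stair_polys_times_var stair_polys_mono g(1) \<phi>(2))
    then show ?thesis
      using g(2) by (simp add: A_def algebra_simps)
  qed
  have ind: "\<exists>g\<in>stair_polys 0 t. \<forall>x\<in>S. g x = (if x = p then 1 else 0)" if p: "p \<in> S" for p
  proof -
    have "\<forall>q\<in>S - {p}. \<exists>j. j < t \<and> p j \<noteq> q j"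
      using sep[OF p] by blast
    then obtain J where J: "\<forall>q\<in>S - {p}. J q < t \<and> p (J q) \<noteq> q (J q)"
      by (rule bchoice[THEN exE])
    have *: "A (\<lambda>x. \<Prod>q\<in>T. 1 / (p (J q) - q (J q)) * (x (J q) - q (J q)))"
      if "finite T" "T \<subseteq> S - {p}" for T
      using that
    proof (induction T)
      case empty
      then show ?case
        using stair_polys_const[of 1 0 t] by (auto simp: A_def)
    next
      case (insert q T)
      then show ?case
        using J A_step[of "\<lambda>x. \<Prod>q\<in>T. 1 / (p (J q) - q (J q)) * (x (J q) - q (J q))" "J q"
            "1 / (p (J q) - q (J q))" "q (J q)"] by simp
    qed
    \<comment> \<open>One affine factor for each other solution \<open>q\<close>, in a coordinate
      \<open>J q\<close> that separates it from \<open>p\<close>: it is zero at \<open>q\<close> and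
      scaled to one at \<open>p\<close>. On \<open>S\<close> the product is the indicator of
      \<open>p\<close>.\<close>
    define \<Phi> where "\<Phi> = (\<lambda>x. \<Prod>q\<in>S - {p}. 1 / (p (J q) - q (J q)) * (x (J q) - q (J q)))"
    have "A \<Phi>"
      using *[of "S - {p}"] assms(3) by (simp add: \<Phi>_def)
    then obtain g where g: "g \<in> stair_polys 0 t"
      "\<forall>x\<in>S. \<Phi> x = g x"
      unfolding A_def by blast
    have "g x = (if x = p then 1 else 0)" if x: "x \<in> S" for x
    proof (cases "x = p")
      case True
      then have "\<Phi> x = 1"
        unfolding \<Phi>_def using J by (intro prod.neutral) auto
      with True g(2) x show ?thesis
        by simp
    next
      case False
      then have "\<Phi> x = 0"
        unfolding \<Phi>_def using assms(3) x by (intro prod_zero bexI[of _ x]) auto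
      with False g(2) x show ?thesis
        by simp
    qed
    with g(1) show ?thesis
      by blast
  qed
  obtain B :: "((nat \<Rightarrow> 'a) \<Rightarrow> 'a) set" where B: "finite B" "card B \<le> fact t"
    "stair_polys 0 t \<subseteq> funspace.span B"
    using stair_polys_span by blast
  have "card S \<le> card B"
    by (rule card_le_of_indicators_in_span[OF B(1) assms(3)]) (use ind B(3) in blast)
  with B(2) show ?thesis
    by linarith
qed

section \<open>Projective norm graphs\<close>

text \<open>On \<open>GF(q^k)\<close> this is the norm down to \<open>GF(q)\<close>.\<close>

definition frob_norm :: "nat \<Rightarrow> nat \<Rightarrow> 'a::comm_monoid_mult \<Rightarrow> 'a" where
  "frob_norm q k x = (\<Prod>j<k. x ^ (q ^ j))"

lemma frob_norm_mult: "frob_norm q k (x * y) = frob_norm q k x * frob_norm q k y"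
  by (simp add: frob_norm_def power_mult_distrib prod.distrib)

lemma frob_norm_divide:
  fixes x y :: "'a::field"
  shows "frob_norm q k (x / y) = frob_norm q k x / frob_norm q k y"
  by (simp add: frob_norm_def power_divide prod_dividef)

lemma frob_norm_eq_0_iff:
  fixes x :: "'a::field"
  assumes "k > 0"
  shows "frob_norm q k x = 0 \<longleftrightarrow> x = 0"
  using assms by (auto simp: frob_norm_def intro!: bexI[of _ 0])

text \<open>The power map is additive in prime characteristic, so equal powers make a power of
  \<open>x - y\<close> vanish.\<close>

lemma frob_inj:
  fixes x y :: "'a::field"
  assumes "Factorial_Ring.prime CHAR('a)" "x ^ (CHAR('a) ^ n) = y ^ (CHAR('a) ^ n)"
  shows "x = y"
proof -
  have "(x - y + y) ^ (CHAR('a) ^ n) = (x - y) ^ (CHAR('a) ^ n) + y ^ (CHAR('a) ^ n)"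
    by (rule freshmans_dream') (use assms(1) in auto)
  then have "(x - y) ^ (CHAR('a) ^ n) = 0"
    using assms(2) by simp
  then show ?thesis
    by simp
qed

text \<open>Dividing the equations by the last one and substituting \<open>y = 1 / (u + A k)\<close> leaves \<open>k\<close> product
  equations in the conjugates \<open>y ^ (q ^ j)\<close>.\<close>

lemma card_common_neighbours_norm_le:
  fixes A \<alpha> :: "nat \<Rightarrow> 'a::field"
  assumes inf: "infinite (UNIV :: 'a set)" and prime: "Factorial_Ring.prime CHAR('a)" and q: "q = CHAR('a) ^ m"
    and k: "k > 0" and inj: "inj_on (\<lambda>i. (A i, \<alpha> i)) {..k}" and fin: "finite W"
    and W: "\<And>u x i. (u, x) \<in> W \<Longrightarrow> i \<le> k \<Longrightarrow> \<alpha> i \<noteq> 0 \<and> x \<noteq> 0 \<and> frob_norm q k (u + A i) = x * \<alpha> i"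
  shows "card W \<le> fact k"
proof (cases "W = {}")
  case False
  then obtain u0 x0 where u0: "(u0, x0) \<in> W"
    by auto
  have \<alpha>: "\<alpha> i \<noteq> 0" if "i \<le> k" for i
    using W[OF u0 that] by simp
  have nz: "u + A i \<noteq> 0" if "(u, x) \<in> W" "i \<le> k" for u x i
    using W[OF that] frob_norm_eq_0_iff[OF k, of q "u + A i"] by auto
  have A_inj: "A i \<noteq> A i'" if "i \<le> k" "i' \<le> k" "i \<noteq> i'" for i i'
  proof
    assume "A i = A i'"
    then have "x0 * \<alpha> i = x0 * \<alpha> i'"
      using W[OF u0 that(1)] W[OF u0 that(2)] by simp
    then have "\<alpha> i = \<alpha> i'"
      using W[OF u0 that(1)] by simp
    with \<open>A i = A i'\<close> inj_onD[OF inj, of i i'] that show False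
      by simp
  qed
  define c where "c = (\<lambda>i. 1 / (A i - A k))"
  define P where "P = (\<lambda>(u, x :: 'a) j. (1 / (u + A k)) ^ (q ^ j))"
  \<comment> \<open>Coordinate \<open>0\<close> carries the exponent \<open>q ^ 0 = 1\<close>, so it
    determines \<open>u\<close>; equation \<open>k\<close> then determines \<open>x\<close>.\<close>
  have P_sep: "P w 0 \<noteq> P w' 0" if w: "w \<in> W" "w' \<in> W" "w \<noteq> w'" for w w'
  proof
    obtain u x u' x' where [simp]: "w = (u, x)" "w' = (u', x')"
      by (cases w, cases w')
    assume "P w 0 = P w' 0"
    then have "u = u'"
      by (simp add: P_def)
    moreover have "x * \<alpha> k = x' * \<alpha> k"
      using W[of u x k] W[of u' x' k] w \<open>u = u'\<close> by simp
    then have "x = x'"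
      using \<alpha>[of k] by simp
    ultimately show False
      using w by simp
  qed
  have "card (P ` W) \<le> fact k"
  proof (rule card_norm_system_solutions_le[OF inf, where
        a = "\<lambda>i j. - (c i ^ (q ^ j))" and b = "\<lambda>i. \<alpha> i / (\<alpha> k * frob_norm q k (A i - A k))"])
    show "- (c i ^ (q ^ j)) \<noteq> - (c i' ^ (q ^ j))" if "i < k" "i' < k" "j < k" "i \<noteq> i'" for i i' j
    proof
      assume "- (c i ^ (q ^ j)) = - (c i' ^ (q ^ j))"
      then have "c i ^ (CHAR('a) ^ (m * j)) = c i' ^ (CHAR('a) ^ (m * j))"
        by (simp add: q power_mult)
      then have "c i = c i'"
        by (rule frob_inj[OF prime])
      then show False
        using A_inj[of i i'] that by (simp add: c_def)
    qed
    show "finite (P ` W)"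
      using fin by simp
    show "(\<Prod>j<k. y j - - (c i ^ (q ^ j))) = \<alpha> i / (\<alpha> k * frob_norm q k (A i - A k))"
      if y: "y \<in> P ` W" and i: "i < k" for y i
    proof -
      obtain u x where w: "(u, x) \<in> W" "y = P (u, x)"
        using y by auto
      have "A i - A k \<noteq> 0"
        using A_inj[of i k] i by simp
      then have "1 / (u + A k) + c i = (u + A i) / ((u + A k) * (A i - A k))"
        using nz[OF w(1), of k] by (simp add: c_def divide_simps)
      moreover have "(1 / (u + A k) + c i) ^ (q ^ j) = y j - - (c i ^ (q ^ j))" for j
      proof -
        have "(1 / (u + A k) + c i) ^ (CHAR('a) ^ (m * j))
            = (1 / (u + A k)) ^ (CHAR('a) ^ (m * j)) + c i ^ (CHAR('a) ^ (m * j))"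
          by (rule freshmans_dream'[OF prime refl])
        then show ?thesis
          by (simp add: w(2) P_def q power_mult)
      qed
      ultimately have "(\<Prod>j<k. y j - - (c i ^ (q ^ j))) = frob_norm q k ((u + A i) / ((u + A k) * (A i - A k)))"
        by (simp add: frob_norm_def)
      also have "\<dots> = x * \<alpha> i / (x * \<alpha> k * frob_norm q k (A i - A k))"
        using W[OF w(1), of i] W[OF w(1), of k] i by (simp add: frob_norm_divide frob_norm_mult)
      \<comment> \<open>The unknown \<open>x\<close> is common to the equations \<open>i\<close> and
        \<open>k\<close> and cancels, so the right-hand side no longer depends on the element of
        \<open>W\<close>.\<close>
      also have "\<dots> = \<alpha> i / (\<alpha> k * frob_norm q k (A i - A k))"
        using W[OF w(1), of k] by simp
      finally show ?thesis .
    qed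
    show "\<exists>j<k. x j \<noteq> y j" if "x \<in> P ` W" "y \<in> P ` W" "x \<noteq> y" for x y
      using that P_sep k by blast
  qed
  moreover have "inj_on P W"
    by (rule inj_onI) (metis P_sep)
  ultimately show ?thesis
    by (simp add: card_image)
qed simp

section \<open>Fixed points of Frobenius powers\<close>

lemma card_frobenius_fixed_points:
  assumes "Factorial_Ring.prime CHAR('a::alg_closed_field)" "q = CHAR('a) ^ m" "m > 0"
  shows "card {x :: 'a. x ^ q = x} = q"
proof -
  have q1: "q > 1"
    unfolding assms(2) using prime_gt_1_nat[OF assms(1)] assms(3) by (rule one_less_power)
  \<comment> \<open>The fixed points are the roots of \<open>X^q - X\<close>. It splits into linear
    factors, and its derivative is \<open>-1\<close> because \<open>q\<close> is zero in the field,
    so no root is repeated.\<close>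
  define p :: "'a poly" where "p = Polynomial.monom 1 q - Polynomial.monom 1 1"
  have poly_p: "poly p x = x ^ q - x" for x
    by (simp add: p_def Polynomial.poly_monom)
  have deg: "Polynomial.degree p = q"
    unfolding p_def diff_conv_add_uminus using q1
    by (subst degree_add_eq_left) (auto simp: Polynomial.degree_monom_eq)
  have lead: "Polynomial.lead_coeff p = 1"
    using q1 by (simp add: deg) (simp add: p_def)
  have "of_nat q = (0 :: 'a)"
    using assms by (simp add: of_nat_eq_0_iff_char_dvd)
  then have deriv: "pderiv p = -1"
    using q1 by (simp add: p_def pderiv_diff pderiv_monom)
  have "p \<noteq> 0"
    using deg q1 by auto
  then obtain A where A: "size A = q" "p = (\<Prod>x\<in>#A. [:-x, 1:])"
    using alg_closed_imp_factorization[of p] deg lead by auto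
  have "count A x \<le> 1" for x
  proof (rule ccontr)
    assume "\<not> count A x \<le> 1"
    then have "replicate_mset 2 x \<subseteq># A"
      by (simp add: count_le_replicate_mset_subset_eq[symmetric])
    then obtain B where "A = replicate_mset 2 x + B"
      by (auto simp: subset_mset.le_iff_add)
    then have "p = [:-x, 1:] * ([:-x, 1:] * (\<Prod>x\<in>#B. [:-x, 1:]))"
      by (simp add: A(2) numeral_2_eq_2)
    then have "poly (pderiv p) x = 0"
      by (simp add: pderiv_mult del: mult_pCons_left mult_pCons_right)
    then show False
      by (simp add: deriv)
  qed
  then have "A = mset_set (set_mset A)"
    by (intro multiset_eqI) (metis count_mset_set(1,3) finite_set_mset le_antisym
        count_greater_eq_one_iff not_in_iff)
  then have "card (set_mset A) = q"
    using A(1) by (metis size_mset_set)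
  moreover have "{x. x ^ q = x} = set_mset A"
  proof -
    have "x ^ q = x \<longleftrightarrow> poly p x = 0" for x
      by (simp add: poly_p)
    also have "\<dots> x \<longleftrightarrow> x \<in># A" for x
      by (auto simp: A(2) poly_prod_mset)
    finally show ?thesis
      by auto
  qed
  ultimately show ?thesis
    by simp
qed

text \<open>A field with \<open>n\<close> elements has no room for \<open>CHAR('a) ^ n > n\<close>
  fixed points of a Frobenius power.\<close>

lemma infinite_alg_closed_prime_char:
  assumes "Factorial_Ring.prime CHAR('a::alg_closed_field)"
  shows "infinite (UNIV :: 'a set)"
proof
  assume fin: "finite (UNIV :: 'a set)"
  define n where "n = card (UNIV :: 'a set)"
  have "n > 0"
    using fin by (simp add: n_def card_gt_0_iff)
  have "n < CHAR('a) ^ n"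
    by (rule power_gt_expt) (use prime_gt_1_nat[OF assms] in simp)
  also have "\<dots> = card {x :: 'a. x ^ (CHAR('a) ^ n) = x}"
    using card_frobenius_fixed_points[OF assms refl \<open>n > 0\<close>] by simp
  also have "\<dots> \<le> n"
    unfolding n_def by (rule card_mono[OF fin]) simp
  finally show False
    by simp
qed

text \<open>Raising to the power \<open>q\<close> permutes the conjugates cyclically: for nonzero
  \<open>x\<close>, both sides times \<open>x\<close> equal the product of the
  \<open>x ^ (q ^ j)\<close> over \<open>j \<le> k\<close>, whose last factor is \<open>x\<close>
  again.\<close>

lemma frob_norm_fixed:
  fixes x :: "'a::field"
  assumes "x ^ (q ^ k) = x" "k > 0" "q > 0"
  shows "frob_norm q k x ^ q = frob_norm q k x"
proof (cases "x = 0")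
  case True
  then show ?thesis
    using assms frob_norm_eq_0_iff[of k q x] by simp
next
  case False
  have "x * frob_norm q k x ^ q = (\<Prod>j<Suc k. x ^ (q ^ j))"
    unfolding prod.lessThan_Suc_shift
    by (simp add: frob_norm_def prod_power_distrib power_mult mult.commute[of q])
  also have "\<dots> = x * frob_norm q k x"
    by (simp add: frob_norm_def assms)
  finally show ?thesis
    using False by simp
qed

lemma CHAR_bit: "CHAR(bit) = 2"
proof (rule CHAR_eqI)
  show "2 dvd n" if "of_nat n = (0 :: bit)" for n
    using that even_of_nat_iff[where 'a = bit, of n] by simp
qed simp


text \<open>The projective norm graph inside the algebraic closure of \<open>GF(2)\<close>:
  \<open>F\<close> and \<open>E\<close> are the subfields with \<open>q\<close> and
  \<open>q ^ k\<close> elements, the vertices are \<open>E \<times> (F - {0})\<close>, and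
  \<open>(A, a)\<close> is adjacent to \<open>(B, b)\<close> if the norm of \<open>A + B\<close> is
  \<open>a * b\<close>. Its ambient field is infinite, as the bound on common neighbours
  demands.\<close>

lemma norm_graph_exists:
  assumes k: "k > 0" and m: "m > 0"
  defines "q \<equiv> 2 ^ m"
  shows "\<exists>(V :: (bit alg_closure \<times> bit alg_closure) set) r. finite V \<and> card V = q ^ k * (q - 1) \<and>
    (\<forall>v w. r v w \<longleftrightarrow> r w v) \<and> (\<forall>v\<in>V. card {w\<in>V. r v w} = q ^ k - 1) \<and>
    (\<forall>D W. D \<subseteq> V \<longrightarrow> W \<subseteq> V \<longrightarrow> card D = Suc k \<longrightarrow> (\<forall>v\<in>D. \<forall>w\<in>W. r v w) \<longrightarrow> card W \<le> fact k)"
proof -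
  have prime: "Factorial_Ring.prime CHAR(bit alg_closure)"
    by (simp add: CHAR_bit)
  have q: "q = CHAR(bit alg_closure) ^ m" "q ^ k = CHAR(bit alg_closure) ^ (m * k)" "q > 0"
    by (simp_all add: q_def CHAR_bit power_mult)
  define F where "F = {x :: bit alg_closure. x ^ q = x}"
  define E where "E = {x :: bit alg_closure. x ^ (q ^ k) = x}"
  have card_F: "card F = q"
    unfolding F_def by (rule card_frobenius_fixed_points[OF prime q(1) m])
  have card_E: "card E = q ^ k"
    unfolding E_def by (rule card_frobenius_fixed_points[OF prime q(2)]) (use m k in simp)
  have fin: "finite F" "finite E"
    using card_F card_E q(3) by (auto intro: card_ge_0_finite)
  have F0: "0 \<in> F"
    using q(3) by (simp add: F_def)
  have E_add: "x + y \<in> E" if "x \<in> E" "y \<in> E" for x y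
    using that freshmans_dream'[OF prime q(2), of x y] by (simp add: E_def)
  \<comment> \<open>In characteristic two \<open>A + B = 0\<close> holds exactly for
    \<open>B = A\<close>, so a vertex misses just one first coordinate, its own: the graph is
    regular and has no loops.\<close>
  have minus_eq: "- x = x" for x :: "bit alg_closure"
    by (rule uminus_CHAR_2) (simp add: CHAR_bit)
  define V where "V = E \<times> (F - {0})"
  define r where "r = (\<lambda>(A, a) (B, b). frob_norm q k (A + B) = a * (b :: bit alg_closure))"
  have finV: "finite V"
    using fin by (simp add: V_def)
  have "card V = q ^ k * (q - 1)"
    using F0 by (simp add: V_def card_cartesian_product card_E card_F)
  moreover have "r v w \<longleftrightarrow> r w v" for v w
    by (cases v, cases w) (simp add: r_def add.commute mult.commute)
  moreover have "card {w\<in>V. r v w} = q ^ k - 1" if v: "v \<in> V" for v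
  proof -
    obtain A a where Aa: "v = (A, a)" "A \<in> E" "a \<in> F" "a \<noteq> 0"
      using v by (auto simp: V_def)
    \<comment> \<open>Every \<open>B\<close> other than \<open>A\<close> has exactly one partner,
      the norm of \<open>A + B\<close> divided by \<open>a\<close>; it lies in \<open>F\<close> by
      \<open>frob_norm_fixed\<close>.\<close>
    have "{w\<in>V. r v w} = (\<lambda>B. (B, frob_norm q k (A + B) / a)) ` (E - {A})"
    proof (intro equalityI subsetI)
      fix w assume "w \<in> {w\<in>V. r v w}"
      then obtain B b where w: "w = (B, b)" "B \<in> E" "b \<noteq> 0" "frob_norm q k (A + B) = a * b"
        by (auto simp: V_def r_def Aa(1))
      have "A + B \<noteq> 0"
        using w(3,4) Aa(4) frob_norm_eq_0_iff[OF k, of q "A + B"] by simp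
      then have "B \<noteq> A"
        using minus_eq[of A] by (metis add.right_inverse)
      then show "w \<in> (\<lambda>B. (B, frob_norm q k (A + B) / a)) ` (E - {A})"
        using w Aa(4) by auto
    next
      fix w assume "w \<in> (\<lambda>B. (B, frob_norm q k (A + B) / a)) ` (E - {A})"
      then obtain B where B: "B \<in> E" "B \<noteq> A" "w = (B, frob_norm q k (A + B) / a)"
        by auto
      have "A + B \<noteq> 0"
        using B(2) minus_eq[of A] by (metis minus_unique)
      then have "frob_norm q k (A + B) \<noteq> 0"
        using frob_norm_eq_0_iff[OF k] by blast
      moreover have "frob_norm q k (A + B) ^ q = frob_norm q k (A + B)"
        using E_add[OF Aa(2) B(1)] by (intro frob_norm_fixed k q(3)) (simp add: E_def)
      ultimately show "w \<in> {w\<in>V. r v w}"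
        using B Aa by (simp add: V_def r_def F_def power_divide)
    qed
    also have "card \<dots> = card (E - {A})"
      by (rule card_image) (auto intro: inj_onI)
    finally show ?thesis
      using Aa(2) by (simp add: card_E)
  qed
  moreover have "card W \<le> fact k"
    if D: "D \<subseteq> V" "W \<subseteq> V" "card D = Suc k" "\<forall>v\<in>D. \<forall>w\<in>W. r v w" for D W
  proof -
    have "finite D"
      using D(1) finV by (rule finite_subset)
    then obtain h where h: "bij_betw h {0..<Suc k} D"
      using ex_bij_betw_nat_finite[of D] D(3) by auto
    have hV: "h i \<in> V" if "i \<le> k" for i
      using bij_betwE[OF h] D(1) that by auto
    show ?thesis
    proof (rule card_common_neighbours_norm_le[OF infinite_alg_closed_prime_char[OF prime] prime q(1) k,
          of "\<lambda>i. fst (h i)" "\<lambda>i. snd (h i)"])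
      show "inj_on (\<lambda>i. (fst (h i), snd (h i))) {..k}"
        using h by (auto simp: bij_betw_def inj_on_def)
      show "finite W"
        using D(2) finV by (rule finite_subset)
      fix B b i assume w: "(B, b) \<in> W" "i \<le> k"
      have "r (h i) (B, b)"
        using D(4) bij_betwE[OF h] w by auto
      then have "frob_norm q k (fst (h i) + B) = snd (h i) * b"
        by (simp add: r_def case_prod_unfold)
      then show "snd (h i) \<noteq> 0 \<and> b \<noteq> 0 \<and> frob_norm q k (B + fst (h i)) = b * snd (h i)"
        using hV[OF w(2)] w(1) D(2) by (auto simp: V_def mult.commute add.commute)
    qed
  qed
  ultimately show ?thesis
    using finV by (intro exI[of _ V] exI[of _ r]) blast
qed

section \<open>Unavoidable induced patterns\<close>

lemma edge_complete_bipartite_iff: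
  "{x, y} \<in> edges (complete_bipartite s t) \<longleftrightarrow>
     (\<exists>i<s. \<exists>j<t. x = Inl i \<and> y = Inr j \<or> x = Inr j \<and> y = Inl i)"
  by (auto simp: complete_bipartite_def edges_def doubleton_eq_iff)

lemma edge_complete_split_iff:
  "{x, y} \<in> edges (complete_split s t) \<longleftrightarrow>
     (\<exists>i<s. \<exists>j<s. i \<noteq> j \<and> x = Inl i \<and> y = Inl j) \<or>
     (\<exists>i<s. \<exists>j<t. x = Inl i \<and> y = Inr j \<or> x = Inr j \<and> y = Inl i)"
  by (auto simp: complete_split_def edges_def doubleton_eq_iff)

lemma verts_complete:
  "verts (complete_bipartite s t) = {..<s} <+> {..<t}"
  "verts (complete_split s t) = {..<s} <+> {..<t}"
  by (simp_all add: complete_bipartite_def complete_split_def verts_def)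

lemma induced_on_simps:
  "verts (induced_on U E) = U"
  "u \<in> U \<Longrightarrow> v \<in> U \<Longrightarrow> {u, v} \<in> edges (induced_on U E) \<longleftrightarrow> {u, v} \<in> E"
  by (auto simp: induced_on_def verts_def edges_def)

lemma obtain_tagging:
  assumes "finite A" "finite W" "A \<inter> W = {}" "card A = s" "card W = t"
  obtains f where "bij_betw f (A \<union> W) ({..<s} <+> {..<t})"
    "\<And>u. u \<in> A \<Longrightarrow> \<exists>i<s. f u = Inl i" "\<And>u. u \<in> W \<Longrightarrow> \<exists>j<t. f u = Inr j"
proof -
  obtain g h where g: "bij_betw g A {..<s}" and h: "bij_betw h W {..<t}"
    using assms by (metis ex_bij_betw_finite_nat lessThan_atLeast0)
  define f where "f = (\<lambda>u. if u \<in> A then Inl (g u) else Inr (h u))"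
  have "bij_betw f A (Inl ` {..<s})"
    using g by (auto simp: bij_betw_def f_def inj_on_def image_image)
  moreover have "bij_betw f W (Inr ` {..<t})"
  proof -
    have "u \<notin> A" if "u \<in> W" for u
      using that assms(3) by blast
    with h show ?thesis
      by (auto simp: bij_betw_def f_def inj_on_def image_image)
  qed
  ultimately have "bij_betw f (A \<union> W) ({..<s} <+> {..<t})"
    unfolding Plus_def by (rule bij_betw_combine) auto
  moreover have "\<exists>i<s. f u = Inl i" if "u \<in> A" for u
    using bij_betwE[OF g] that by (auto simp: f_def)
  moreover have "\<exists>j<t. f u = Inr j" if "u \<in> W" for u
    using bij_betwE[OF h] that assms(3) by (auto simp: f_def)
  ultimately show thesis
    by (rule that)
qed

lemma sgraph_iso_complete_bipartiteI:
  assumes "finite A" "finite W" "A \<inter> W = {}" "card A = s" "card W = t"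
    and "\<And>u v. u \<in> A \<Longrightarrow> v \<in> A \<Longrightarrow> {u, v} \<notin> E"
    and "\<And>u v. u \<in> W \<Longrightarrow> v \<in> W \<Longrightarrow> {u, v} \<notin> E"
    and "\<And>u v. u \<in> A \<Longrightarrow> v \<in> W \<Longrightarrow> {u, v} \<in> E"
  shows "sgraph_iso (induced_on (A \<union> W) E) (complete_bipartite s t)"
proof -
  obtain f where f: "bij_betw f (A \<union> W) ({..<s} <+> {..<t})"
    "\<And>u. u \<in> A \<Longrightarrow> \<exists>i<s. f u = Inl i" "\<And>u. u \<in> W \<Longrightarrow> \<exists>j<t. f u = Inr j"
    using obtain_tagging[OF assms(1-5)] by blast
  have "{u, v} \<in> E \<longleftrightarrow> {f u, f v} \<in> edges (complete_bipartite s t)"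
    if "u \<in> A \<union> W" "v \<in> A \<union> W" for u v
  proof (cases "u \<in> A"; cases "v \<in> A")
    assume "u \<in> A" "v \<in> A"
    then show ?thesis
      using assms(6) f(2)[of u] f(2)[of v] by (auto simp: edge_complete_bipartite_iff)
  next
    assume "u \<in> A" "v \<notin> A"
    then show ?thesis
      using assms(8) f(2)[of u] f(3)[of v] that by (auto simp: edge_complete_bipartite_iff)
  next
    assume "u \<notin> A" "v \<in> A"
    then show ?thesis
      using assms(8)[of v u] f(2)[of v] f(3)[of u] that
      by (auto simp: edge_complete_bipartite_iff insert_commute)
  next
    assume "u \<notin> A" "v \<notin> A"
    then show ?thesis
      using assms(7) f(3)[of u] f(3)[of v] that by (auto simp: edge_complete_bipartite_iff)
  qed
  with f(1) show ?thesis
    unfolding sgraph_iso_def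
    by (intro exI[of _ f]) (simp add: induced_on_simps verts_complete)
qed

lemma sgraph_iso_complete_splitI:
  assumes "finite A" "finite W" "A \<inter> W = {}" "card A = s" "card W = t"
    and "\<And>u v. u \<in> A \<Longrightarrow> v \<in> A \<Longrightarrow> {u, v} \<in> E \<longleftrightarrow> u \<noteq> v"
    and "\<And>u v. u \<in> W \<Longrightarrow> v \<in> W \<Longrightarrow> {u, v} \<notin> E"
    and "\<And>u v. u \<in> A \<Longrightarrow> v \<in> W \<Longrightarrow> {u, v} \<in> E"
  shows "sgraph_iso (induced_on (A \<union> W) E) (complete_split s t)"
proof -
  obtain f where f: "bij_betw f (A \<union> W) ({..<s} <+> {..<t})"
    "\<And>u. u \<in> A \<Longrightarrow> \<exists>i<s. f u = Inl i" "\<And>u. u \<in> W \<Longrightarrow> \<exists>j<t. f u = Inr j"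
    using obtain_tagging[OF assms(1-5)] by blast
  have "{u, v} \<in> E \<longleftrightarrow> {f u, f v} \<in> edges (complete_split s t)"
    if "u \<in> A \<union> W" "v \<in> A \<union> W" for u v
  proof (cases "u \<in> A"; cases "v \<in> A")
    assume uv: "u \<in> A" "v \<in> A"
    have "f u = f v \<longleftrightarrow> u = v"
      using f(1) that by (auto simp: bij_betw_def inj_on_def)
    with uv show ?thesis
      using assms(6) f(2)[of u] f(2)[of v] by (auto simp: edge_complete_split_iff)
  next
    assume "u \<in> A" "v \<notin> A"
    then show ?thesis
      using assms(8) f(2)[of u] f(3)[of v] that by (auto simp: edge_complete_split_iff)
  next
    assume "u \<notin> A" "v \<in> A"
    then show ?thesis
      using assms(8)[of v u] f(2)[of v] f(3)[of u] that
      by (auto simp: edge_complete_split_iff insert_commute)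
  next
    assume "u \<notin> A" "v \<notin> A"
    then show ?thesis
      using assms(7) f(3)[of u] f(3)[of v] that by (auto simp: edge_complete_split_iff)
  qed
  with f(1) show ?thesis
    unfolding sgraph_iso_def
    by (intro exI[of _ f]) (simp add: induced_on_simps verts_complete)
qed

lemma two_edge_coloring_edge:
  assumes "two_edge_coloring n R B" "u < n" "v < n" "u \<noteq> v"
  shows "{u, v} \<in> B \<longleftrightarrow> {u, v} \<notin> R"
proof -
  have "{u, v} \<in> all_edges {..<n}"
    using assms(2-4) by (simp add: all_edges_def)
  then show ?thesis
    using assms(1) unfolding two_edge_coloring_def by blast
qed

text \<open>\<open>{u, v}\<close> with \<open>u = v\<close> is the singleton \<open>{u}\<close>;
  this settles the diagonal wherever edges are written as \<open>{u, v}\<close>.\<close>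

lemma two_edge_coloring_loop:
  assumes "two_edge_coloring n R B"
  shows "{u} \<notin> R" "{u} \<notin> B"
proof -
  have "card e = 2" if "e \<in> R \<union> B" for e
    using assms that by (auto simp: two_edge_coloring_def all_edges_def)
  then show "{u} \<notin> R" "{u} \<notin> B"
    by force+
qed

lemma two_edge_coloring_commute:
  "two_edge_coloring n R B \<longleftrightarrow> two_edge_coloring n B R"
  by (auto simp: two_edge_coloring_def)

lemma has_induced_mono_commute:
  "has_induced_mono n R B H \<longleftrightarrow> has_induced_mono n B R H"
  by (auto simp: has_induced_mono_def)

lemma has_induced_mono_bipartiteI:
  assumes col: "two_edge_coloring n R B" and "A \<subseteq> {..<n}" "W \<subseteq> {..<n}"
    "A \<inter> W = {}" "card A = s" "card W = t" "indep A R" "indep W R"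
    and "\<And>u v. u \<in> A \<Longrightarrow> v \<in> W \<Longrightarrow> {u, v} \<in> R"
  shows "has_induced_mono n R B (complete_bipartite s t)"
proof -
  have fin: "finite A" "finite W"
    using assms(2,3) by (auto intro: finite_subset)
  have no: "{u, v} \<notin> R" if "u \<in> S" "v \<in> S" "indep S R" for u v S
    using that two_edge_coloring_loop[OF col] by (cases "u = v") (auto simp: indep_def)
  have "sgraph_iso (induced_on (A \<union> W) R) (complete_bipartite s t)"
    by (rule sgraph_iso_complete_bipartiteI) (use assms fin no in auto)
  moreover have "card (A \<union> W) = card (verts (complete_bipartite s t))"
    using assms fin by (simp add: verts_complete card_Un_disjoint card_Plus)
  ultimately show ?thesis
    unfolding has_induced_mono_def using assms(2,3) by blast
qed

lemma has_induced_mono_splitI: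
  assumes col: "two_edge_coloring n R B" and "A \<subseteq> {..<n}" "W \<subseteq> {..<n}"
    "A \<inter> W = {}" "card A = s" "card W = t" "clique A R" "indep W R"
    and "\<And>u v. u \<in> A \<Longrightarrow> v \<in> W \<Longrightarrow> {u, v} \<in> R"
  shows "has_induced_mono n R B (complete_split s t)"
proof -
  have fin: "finite A" "finite W"
    using assms(2,3) by (auto intro: finite_subset)
  have "{u, v} \<notin> R" if "u \<in> W" "v \<in> W" for u v
    using that assms(8) two_edge_coloring_loop[OF col] by (cases "u = v") (auto simp: indep_def)
  moreover have "{u, v} \<in> R \<longleftrightarrow> u \<noteq> v" if "u \<in> A" "v \<in> A" for u v
    using that assms(7) two_edge_coloring_loop[OF col] by (cases "u = v") (auto simp: clique_def)
  ultimately have "sgraph_iso (induced_on (A \<union> W) R) (complete_split s t)"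
    by (intro sgraph_iso_complete_splitI) (use assms fin in auto)
  moreover have "card (A \<union> W) = card (verts (complete_split s t))"
    using assms fin by (simp add: verts_complete card_Un_disjoint card_Plus)
  ultimately show ?thesis
    unfolding has_induced_mono_def using assms(2,3) by blast
qed

section \<open>Ramsey argument between a red and a blue clique\<close>

lemma split_nat_set:
  fixes H :: "nat set"
  assumes "finite H" "card H = a + b"
  obtains I J where "I \<subseteq> H" "J \<subseteq> H" "card I = a" "card J = b" "\<And>i j. i \<in> I \<Longrightarrow> j \<in> J \<Longrightarrow> i < j"
proof
  let ?xs = "sorted_list_of_set H"
  show "set (take a ?xs) \<subseteq> H" "set (drop a ?xs) \<subseteq> H"
    using set_take_subset[of a ?xs] set_drop_subset[of a ?xs] assms(1) by auto
  show "card (set (take a ?xs)) = a" "card (set (drop a ?xs)) = b"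
    using assms by (simp_all add: distinct_card)
  have "sorted_wrt (<) (take a ?xs @ drop a ?xs)"
    by simp
  then show "i < j" if "i \<in> set (take a ?xs)" "j \<in> set (drop a ?xs)" for i j
    using that unfolding sorted_wrt_append by blast
qed

text \<open>Colouring the pair \<open>i < j\<close> by the colour of \<open>x\<^sub>i y\<^sub>j\<close> turns the bipartite Ramsey
  problem between the two cliques into the ordinary one.\<close>

lemma opposite_cliques_force_split:
  shows "\<exists>r. \<forall>n R B P Q. two_edge_coloring n R B \<longrightarrow> P \<subseteq> {..<n} \<longrightarrow> Q \<subseteq> {..<n} \<longrightarrow>
    card P = r \<longrightarrow> card Q = r \<longrightarrow> clique P R \<longrightarrow> indep Q R \<longrightarrow>
    has_induced_mono n R B (complete_split t t)"
proof -
  obtain r where r: "\<forall>(V :: nat set) E. finite V \<and> card V \<ge> r \<longrightarrow>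
    (\<exists>H \<subseteq> V. card H = t + t \<and> clique H E \<or> card H = t + t \<and> indep H E)"
    using ramsey2[where 'a = nat and m = "t + t" and n = "t + t"] by blast
  show ?thesis
  proof (intro exI[of _ "Suc r"] allI impI)
    fix n R B P Q
    assume col: "two_edge_coloring n R B" and PQ: "P \<subseteq> {..<n}" "Q \<subseteq> {..<n}"
      "card P = Suc r" "card Q = Suc r" "clique P R" "indep Q R"
    have fin: "finite P" "finite Q"
      using PQ by (auto intro: finite_subset)
    \<comment> \<open>Two common vertices would be joined in red by \<open>P\<close> and not in red
      by \<open>Q\<close>. The size \<open>Suc r\<close> allows for removing the one vertex that may
      be shared.\<close>
    have "card (P \<inter> Q) \<le> 1"
    proof (rule ccontr)
      assume "\<not> card (P \<inter> Q) \<le> 1"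
      then obtain u v where "u \<in> P \<inter> Q" "v \<in> P \<inter> Q" "u \<noteq> v"
        using card_le_Suc0_iff_eq[of "P \<inter> Q"] fin by auto
      then show False
        using PQ(5,6) by (auto simp: clique_def indep_def)
    qed
    then have "r \<le> card (P - Q)"
      using PQ(3) fin card_Diff_subset_Int[of P Q] by simp
    then obtain P' where P': "P' \<subseteq> P - Q" "card P' = r"
      by (meson obtain_subset_with_card_n)
    obtain Q' where Q': "Q' \<subseteq> Q" "card Q' = r"
      using PQ(4) by (metis le_add2 obtain_subset_with_card_n plus_1_eq_Suc)
    have fin': "finite P'" "finite Q'"
      using P' Q' fin by (auto intro: finite_subset)
    obtain x y where x: "bij_betw x {..<r} P'" and y: "bij_betw y {..<r} Q'"
      using ex_bij_betw_nat_finite[OF fin'(1)] ex_bij_betw_nat_finite[OF fin'(2)] P'(2) Q'(2)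
      by (auto simp: atLeast0LessThan)
    define E where "E = {{i, j} | i j. i < j \<and> {x i, y j} \<in> R}"
    have E: "{i, j} \<in> E \<longleftrightarrow> {x i, y j} \<in> R" if "i < j" for i j
      using that by (auto simp: E_def doubleton_eq_iff)
    obtain H where H: "H \<subseteq> {..<r}" "card H = t + t" "clique H E \<or> indep H E"
      using r[rule_format, of "{..<r}" E] by auto
    \<comment> \<open>The lower and the upper half of \<open>H\<close>: since \<open>i < j\<close>
      for all \<open>i\<close> in \<open>I\<close> and \<open>j\<close> in \<open>J\<close>,
      homogeneity of \<open>H\<close> decides the colour of every pair \<open>x i\<close>,
      \<open>y j\<close>.\<close>
    then obtain I J where IJ: "I \<subseteq> H" "J \<subseteq> H" "card I = t" "card J = t"
      "\<And>i j. i \<in> I \<Longrightarrow> j \<in> J \<Longrightarrow> i < j"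
      using split_nat_set[of H t t] finite_subset[OF H(1)] by auto
    define A where "A = x ` I"
    define W where "W = y ` J"
    have "A \<subseteq> P'" "W \<subseteq> Q'"
      using IJ(1,2) H(1) x y by (auto simp: A_def W_def bij_betw_def)
    then have sub: "A \<subseteq> P - Q" "W \<subseteq> Q"
      using P'(1) Q'(1) by auto
    then have AW: "A \<subseteq> {..<n}" "W \<subseteq> {..<n}" "A \<inter> W = {}" "W \<inter> A = {}"
      using PQ(1,2) by blast+
    have AW': "clique A R" "indep W R"
      using sub smaller_clique[OF PQ(5), of A] smaller_indep[OF PQ(6), of W] by auto
    have "inj_on x I" "inj_on y J"
      using IJ(1,2) H(1) by (auto intro!: inj_on_subset[OF bij_betw_imp_inj_on[OF x]]
          inj_on_subset[OF bij_betw_imp_inj_on[OF y]])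
    then have cards: "card A = t" "card W = t"
      using IJ(3,4) by (simp_all add: A_def W_def card_image)
    show "has_induced_mono n R B (complete_split t t)"
    proof (cases "clique H E")
      case True
      have "{u, v} \<in> R" if uv: "u \<in> A" "v \<in> W" for u v
      proof -
        obtain i j where ij: "i \<in> I" "j \<in> J" "u = x i" "v = y j"
          using uv by (auto simp: A_def W_def)
        then have "i \<in> H" "j \<in> H" "i \<noteq> j"
          using IJ(1,2) IJ(5)[OF ij(1,2)] by auto
        then have "{i, j} \<in> E"
          using True by (simp add: clique_def)
        then show ?thesis
          using E IJ(5) ij by simp
      qed
      then show ?thesis
        by (intro has_induced_mono_splitI[OF col AW(1,2,3) cards AW'])
    next
      case False
      then have ind: "indep H E"
        using H(3) by blast
      have B_iff: "{u, v} \<in> B \<longleftrightarrow> {u, v} \<notin> R" if "u < n" "v < n" "u \<noteq> v" for u v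
        using two_edge_coloring_edge[OF col that] .
      have "{v, u} \<in> B" if uv: "u \<in> A" "v \<in> W" for u v
      proof -
        obtain i j where ij: "i \<in> I" "j \<in> J" "u = x i" "v = y j"
          using uv by (auto simp: A_def W_def)
        then have "i \<in> H" "j \<in> H" "i \<noteq> j"
          using IJ(1,2) IJ(5)[OF ij(1,2)] by auto
        then have "{i, j} \<notin> E"
          using ind by (simp add: indep_def)
        then have "{u, v} \<notin> R"
          using E IJ(5) ij by simp
        moreover have "u < n" "v < n" "v \<noteq> u"
          using uv AW(1-3) by auto
        ultimately show ?thesis
          using B_iff by (simp add: insert_commute)
      qed
      \<comment> \<open>In blue the roles are exchanged: \<open>W\<close> is the clique and
        \<open>A\<close> the independent set.\<close>
      moreover have "clique W B" "indep A B"
        using AW AW' B_iff by (auto simp: clique_def indep_def subset_iff)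
      ultimately have "has_induced_mono n B R (complete_split t t)"
        using col two_edge_coloring_commute[of n]
        by (intro has_induced_mono_splitI[OF _ AW(2,1,4) cards(2,1)]) auto
      then show ?thesis
        by (simp add: has_induced_mono_commute[of n R B])
    qed
  qed
qed

section \<open>Double counting of blue sets in red neighbourhoods\<close>

lemma count_subsets_with_property:
  fixes N :: "'a set"
  assumes "finite N" "s \<le> r" and "\<And>Y. Y \<subseteq> N \<Longrightarrow> card Y = r \<Longrightarrow> \<exists>A\<subseteq>Y. card A = s \<and> P A"
  shows "card N choose s \<le> (r choose s) * card {A. A \<subseteq> N \<and> card A = s \<and> P A} \<or> card N < r"
proof (rule disjCI)
  assume "\<not> card N < r"
  then have r: "r \<le> card N"
    by simp
  define \<A> where "\<A> = {A. A \<subseteq> N \<and> card A = s \<and> P A}"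
  have fin\<A>: "finite \<A>"
    using assms(1) by (simp add: \<A>_def)
  \<comment> \<open>Pairs \<open>A \<subseteq> Y\<close> with \<open>card Y = r\<close> are counted:
    every \<open>Y\<close> contains an admissible \<open>A\<close>, and every \<open>A\<close> lies
    in \<open>(card N - s) choose (r - s)\<close> of the sets \<open>Y\<close>. The identity
    \<open>choose_mult\<close> then brings in \<open>card N choose s\<close>.\<close>
  have "card N choose r = card {Y. Y \<subseteq> N \<and> card Y = r}"
    using assms(1) by (simp add: n_subsets)
  also have "\<dots> \<le> card (\<Union>A\<in>\<A>. {Y. A \<subseteq> Y \<and> Y \<subseteq> N \<and> card Y = r})"
  proof (rule card_mono)
    show "finite (\<Union>A\<in>\<A>. {Y. A \<subseteq> Y \<and> Y \<subseteq> N \<and> card Y = r})"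
      using fin\<A> assms(1) by simp
    show "{Y. Y \<subseteq> N \<and> card Y = r} \<subseteq> (\<Union>A\<in>\<A>. {Y. A \<subseteq> Y \<and> Y \<subseteq> N \<and> card Y = r})"
    proof
      fix Y assume "Y \<in> {Y. Y \<subseteq> N \<and> card Y = r}"
      then have Y: "Y \<subseteq> N" "card Y = r"
        by auto
      then obtain A where "A \<subseteq> Y" "card A = s" "P A"
        using assms(3) by blast
      with Y show "Y \<in> (\<Union>A\<in>\<A>. {Y. A \<subseteq> Y \<and> Y \<subseteq> N \<and> card Y = r})"
        unfolding \<A>_def by (intro UN_I[of A]) auto
    qed
  qed
  also have "\<dots> \<le> (\<Sum>A\<in>\<A>. card {Y. A \<subseteq> Y \<and> Y \<subseteq> N \<and> card Y = r})"
    by (rule card_UN_le[OF fin\<A>])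
  also have "\<dots> \<le> (\<Sum>A\<in>\<A>. (card N - s) choose (r - s))"
  proof (rule sum_mono)
    fix A assume "A \<in> \<A>"
    then have A: "A \<subseteq> N" "card A = s"
      by (auto simp: \<A>_def)
    then have finA: "finite A"
      using assms(1) finite_subset by blast
    have "card {Y. A \<subseteq> Y \<and> Y \<subseteq> N \<and> card Y = r} \<le> card {Z. Z \<subseteq> N - A \<and> card Z = r - s}"
    proof (rule card_inj_on_le)
      show "inj_on (\<lambda>Y. Y - A) {Y. A \<subseteq> Y \<and> Y \<subseteq> N \<and> card Y = r}"
        by (rule inj_onI) blast
      show "(\<lambda>Y. Y - A) ` {Y. A \<subseteq> Y \<and> Y \<subseteq> N \<and> card Y = r} \<subseteq> {Z. Z \<subseteq> N - A \<and> card Z = r - s}"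
        using A finA by (auto simp: card_Diff_subset)
    qed (use assms(1) in simp)
    also have "\<dots> = (card N - s) choose (r - s)"
      using assms(1) A finA by (simp add: n_subsets card_Diff_subset)
    finally show "card {Y. A \<subseteq> Y \<and> Y \<subseteq> N \<and> card Y = r} \<le> (card N - s) choose (r - s)" .
  qed
  finally have "card N choose r \<le> card \<A> * ((card N - s) choose (r - s))"
    by simp
  then have "(card N choose r) * (r choose s) \<le> card \<A> * ((card N - s) choose (r - s)) * (r choose s)"
    by (rule mult_le_mono1)
  then have "(card N choose s) * ((card N - s) choose (r - s))
      \<le> (r choose s) * card \<A> * ((card N - s) choose (r - s))"
    unfolding choose_mult[OF assms(2) r] by (simp add: mult_ac)
  moreover have "(card N - s) choose (r - s) > 0"
    using r by simp
  ultimately show "card N choose s \<le> (r choose s) * card {A. A \<subseteq> N \<and> card A = s \<and> P A}"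
    unfolding \<A>_def[symmetric] by simp
qed

text \<open>Below \<open>a\<close> the left side is not positive; above it, both factors are at most
  the matching powers of \<open>x\<close>. Summing this linear bound does the work of the power mean
  inequality.\<close>

lemma power_ge_tangent:
  fixes x a :: real
  assumes "x \<ge> 0" "a \<ge> 0" "s > 0"
  shows "a ^ (s - 1) * (x - a) \<le> x ^ s"
proof (cases "a \<le> x")
  case True
  have "a ^ (s - 1) * (x - a) \<le> x ^ (s - 1) * x"
    by (intro mult_mono power_mono) (use assms True in auto)
  then show ?thesis
    using assms(3) by (simp add: power_eq_if mult.commute)
next
  case False
  then have "a ^ (s - 1) * (x - a) \<le> 0"
    using assms(2) by (intro mult_nonneg_nonpos) auto
  also have "0 \<le> x ^ s"
    using assms(1) by simp
  finally show ?thesis .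
qed

lemma degree_sum_bound:
  fixes d :: "nat \<Rightarrow> nat" and M :: real
  assumes "s > 0" "n > 0" "M \<ge> 0" "(\<Sum>v<n. real (d v choose s)) \<le> M * real n ^ s"
  shows "(\<Sum>v<n. real (d v)) \<le> real s * (2 + M) * real n powr (2 - 1 / real s)"
proof -
  \<comment> \<open>For \<open>s \<le> d\<close> the power \<open>(d / s) ^ s\<close> is at most
    \<open>d choose s\<close>. Smaller degrees are replaced by zero, which the \<open>+ 1\<close> in
    \<open>d_le\<close> makes up for.\<close>
  define x where "x = (\<lambda>v. if s \<le> d v then real (d v) / real s else 0)"
  have x0: "x v \<ge> 0" for v
    by (simp add: x_def)
  have x_pow: "x v ^ s \<le> real (d v choose s)" for v
    using binomial_ge_n_over_k_pow_k[of s "d v", where 'a = real] assms(1) by (simp add: x_def zero_power)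
  have d_le: "real (d v) \<le> real s * (x v + 1)" for v
    using assms(1) by (auto simp: x_def algebra_simps)
  \<comment> \<open>The point \<open>a\<close> balances the error terms: as
    \<open>a ^ s = n ^ (s - 1)\<close>, both \<open>n * a\<close> and
    \<open>M * n ^ s / a ^ (s - 1)\<close> are multiples of
    \<open>n powr (2 - 1 / s)\<close>.\<close>
  define a where "a = real n powr (1 - 1 / real s)"
  have a0: "a > 0"
    using assms(2) by (simp add: a_def)
  have an: "a * real n = real n powr (2 - 1 / real s)"
    using assms(2) powr_add[of "real n" "1 - 1 / real s" 1] by (simp add: a_def)
  have as: "a * a ^ (s - 1) = real n ^ (s - 1)"
  proof -
    have "a * a ^ (s - 1) = a ^ s"
      using assms(1) by (simp add: power_eq_if)
    also have "\<dots> = real n powr ((1 - 1 / real s) * real s)"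
      using a0 assms(2) by (simp add: a_def powr_powr[symmetric] powr_realpow)
    also have "(1 - 1 / real s) * real s = real (s - 1)"
      using assms(1) by (simp add: algebra_simps of_nat_diff)
    finally show ?thesis
      using assms(2) by (simp add: powr_realpow)
  qed
  have "a ^ (s - 1) * ((\<Sum>v<n. x v) - real n * a) = (\<Sum>v<n. a ^ (s - 1) * (x v - a))"
    by (simp add: sum_distrib_left sum_subtractf right_diff_distrib)
  also have "\<dots> \<le> (\<Sum>v<n. x v ^ s)"
    by (intro sum_mono power_ge_tangent x0) (use a0 assms(1) in auto)
  also have "\<dots> \<le> (\<Sum>v<n. real (d v choose s))"
    by (intro sum_mono x_pow)
  also have "\<dots> \<le> M * real n ^ s"
    by (rule assms(4))
  also have "\<dots> = a ^ (s - 1) * (M * (a * real n))"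
    using as assms(1) by (simp add: power_eq_if mult_ac)
  finally have "(\<Sum>v<n. x v) - real n * a \<le> M * (a * real n)"
    using a0 by simp
  then have sum_x: "(\<Sum>v<n. x v) \<le> (1 + M) * real n powr (2 - 1 / real s)"
    by (simp add: an algebra_simps)
  have "real n = real n powr 1"
    using assms(2) by simp
  also have "\<dots> \<le> real n powr (2 - 1 / real s)"
    using assms(1,2) by (intro powr_mono) (auto simp: divide_simps)
  finally have n_le: "real n \<le> real n powr (2 - 1 / real s)" .
  have "(\<Sum>v<n. real (d v)) \<le> (\<Sum>v<n. real s * (x v + 1))"
    by (intro sum_mono d_le)
  also have "\<dots> = real s * ((\<Sum>v<n. x v) + real n)"
    by (simp add: sum_distrib_left[symmetric] sum.distrib)
  also have "\<dots> \<le> real s * ((1 + M) * real n powr (2 - 1 / real s) + real n powr (2 - 1 / real s))"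
    by (intro mult_left_mono add_mono sum_x n_le) auto
  finally show ?thesis
    by (simp add: algebra_simps)
qed

text \<open>Pairs of a vertex and a blue \<open>s\<close>-set in its red neighbourhood are counted.
  From below, Ramsey without red \<open>k\<close>-cliques finds such a set in every
  \<open>r\<close>-subset of the neighbourhood; from above, no such set has more than
  \<open>q\<close> common red neighbours.\<close>

lemma few_edges_without_clique:
  assumes "s > 0"
  shows "\<exists>C>0. \<forall>n R B. n > 0 \<longrightarrow> two_edge_coloring n R B \<longrightarrow>
    (\<forall>P\<subseteq>{..<n}. card P = k \<longrightarrow> \<not> clique P R) \<longrightarrow>
    \<not> has_induced_mono n R B (complete_bipartite s t) \<longrightarrow>
    real (card R) \<le> C * real n powr (2 - 1 / real s)"
proof -
  obtain r0 where r0: "\<forall>(V :: nat set) E. finite V \<and> card V \<ge> r0 \<longrightarrow>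
    (\<exists>H \<subseteq> V. card H = k \<and> clique H E \<or> card H = s \<and> indep H E)"
    using ramsey2[where 'a = nat and m = k and n = s] by blast
  obtain q where q: "\<forall>(V :: nat set) E. finite V \<and> card V \<ge> q \<longrightarrow>
    (\<exists>H \<subseteq> V. card H = k \<and> clique H E \<or> card H = t \<and> indep H E)"
    using ramsey2[where 'a = nat and m = k and n = t] by blast
  \<comment> \<open>\<open>r\<close> is at least \<open>s\<close> as
    \<open>count_subsets_with_property\<close> requires. In \<open>M\<close> the first summand comes
    from the count of pairs, the second from the vertices of red degree below
    \<open>r\<close>.\<close>
  define r where "r = max r0 s"
  define M where "M = real (r choose s) * real q + real (r ^ s)"
  have "real (card R) \<le> real s * (2 + M) * real n powr (2 - 1 / real s)"
    if n: "n > 0" and col: "two_edge_coloring n R B"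
      and no_clique: "\<And>P. P \<subseteq> {..<n} \<Longrightarrow> card P = k \<Longrightarrow> \<not> clique P R"
      and no_bip: "\<not> has_induced_mono n R B (complete_bipartite s t)" for n R B
  proof -
    define N where "N = (\<lambda>v. {u. u < n \<and> {v, u} \<in> R})"
    have N: "N v \<subseteq> {..<n}" "finite (N v)" for v
      by (auto simp: N_def)
    define \<A> where "\<A> = {A. A \<subseteq> {..<n} \<and> card A = s \<and> indep A R}"
    have fin\<A>: "finite \<A>"
      by (simp add: \<A>_def)
    have "card \<A> \<le> card {A. A \<subseteq> {..<n} \<and> card A = s}"
      by (rule card_mono) (auto simp: \<A>_def)
    also have "\<dots> = n choose s"
      by (simp add: n_subsets)
    also have "\<dots> \<le> n ^ s"
      using binomial_le_pow[of s n] by (cases "s \<le> n") (auto simp: binomial_eq_0)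
    finally have card\<A>: "card \<A> \<le> n ^ s" .
    \<comment> \<open>More than \<open>q\<close> common neighbours would contain a blue
      \<open>t\<close>-set, red \<open>k\<close>-cliques being excluded; with \<open>A\<close> it
      would form an induced red \<open>complete_bipartite s t\<close>.\<close>
    have few: "card {v. v < n \<and> A \<subseteq> N v} \<le> q" if A: "A \<in> \<A>" for A
    proof (rule ccontr)
      assume "\<not> card {v. v < n \<and> A \<subseteq> N v} \<le> q"
      then have "\<exists>H\<subseteq>{v. v < n \<and> A \<subseteq> N v}. card H = k \<and> clique H R \<or> card H = t \<and> indep H R"
        using q by simp
      then obtain W where W: "W \<subseteq> {v. v < n \<and> A \<subseteq> N v}" "card W = t" "indep W R"
        using no_clique by (metis (no_types, lifting) lessThan_iff mem_Collect_eq subset_iff)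
      have cross: "{u, v} \<in> R" if "u \<in> A" "v \<in> W" for u v
      proof -
        have "{v, u} \<in> R"
          using that W(1) unfolding N_def by blast
        then show ?thesis
          by (simp add: insert_commute)
      qed
      then have "A \<inter> W = {}"
        using two_edge_coloring_loop(1)[OF col] by fastforce
      then have "has_induced_mono n R B (complete_bipartite s t)"
        using A W cross by (intro has_induced_mono_bipartiteI[OF col, of A W]) (auto simp: \<A>_def)
      with no_bip show False
        by simp
    qed
    have many: "card (N v) choose s \<le> (r choose s) * card {A\<in>\<A>. A \<subseteq> N v} + r ^ s" for v
    proof -
      have "\<exists>A\<subseteq>Y. card A = s \<and> indep A R" if Y: "Y \<subseteq> N v" "card Y = r" for Y
      proof -
        have "finite Y"
          using Y(1) N(2) by (rule finite_subset)
        then obtain H where "H \<subseteq> Y" "card H = k \<and> clique H R \<or> card H = s \<and> indep H R"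
          using r0[rule_format, of Y R] Y(2) unfolding r_def by auto
        then show ?thesis
          using no_clique[of H] Y(1) N(1)[of v] by blast
      qed
      then have "card (N v) choose s \<le> (r choose s) * card {A. A \<subseteq> N v \<and> card A = s \<and> indep A R}
          \<or> card (N v) < r"
        by (intro count_subsets_with_property N(2)) (auto simp: r_def)
      moreover have "{A. A \<subseteq> N v \<and> card A = s \<and> indep A R} = {A\<in>\<A>. A \<subseteq> N v}"
        using N(1) by (auto simp: \<A>_def)
      moreover have "card (N v) choose s \<le> r ^ s" if "card (N v) < r"
      proof (cases "s \<le> card (N v)")
        case True
        then have "card (N v) choose s \<le> card (N v) ^ s"
          by (rule binomial_le_pow)
        also have "\<dots> \<le> r ^ s"
          using that by (intro power_mono) auto
        finally show ?thesis .
      qed (simp add: binomial_eq_0)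
      ultimately show ?thesis
        by auto
    qed
    have "(\<Sum>v<n. card {A\<in>\<A>. A \<subseteq> N v}) = (\<Sum>A\<in>\<A>. card {v\<in>{..<n}. A \<subseteq> N v})"
      by (rule sum_multicount_gen) (use fin\<A> in auto)
    also have "\<dots> \<le> (\<Sum>A\<in>\<A>. q)"
      by (intro sum_mono) (use few in simp)
    also have "\<dots> \<le> q * n ^ s"
      using card\<A> by (simp add: mult.commute)
    finally have "(r choose s) * (\<Sum>v<n. card {A\<in>\<A>. A \<subseteq> N v}) \<le> (r choose s) * (q * n ^ s)"
      by (rule mult_le_mono2)
    moreover have "(\<Sum>v<n. card (N v) choose s)
        \<le> (\<Sum>v<n. (r choose s) * card {A\<in>\<A>. A \<subseteq> N v} + r ^ s)"
      by (intro sum_mono many)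
    ultimately have "(\<Sum>v<n. card (N v) choose s) \<le> (r choose s) * (q * n ^ s) + n * r ^ s"
      by (simp add: sum.distrib sum_distrib_left)
    also have "n * r ^ s \<le> r ^ s * n ^ s"
      using self_le_power[of n s] assms n by simp
    finally have "(\<Sum>v<n. card (N v) choose s) \<le> ((r choose s) * q + r ^ s) * n ^ s"
      by (simp add: algebra_simps)
    then have "real (\<Sum>v<n. card (N v) choose s) \<le> real (((r choose s) * q + r ^ s) * n ^ s)"
      by (simp only: of_nat_le_iff)
    then have "(\<Sum>v<n. real (card (N v) choose s)) \<le> M * real n ^ s"
      by (simp add: M_def)
    then have sum_le: "(\<Sum>v<n. real (card (N v))) \<le> real s * (2 + M) * real n powr (2 - 1 / real s)"
      using assms n by (intro degree_sum_bound) (auto simp: M_def)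
    have "R \<subseteq> (\<Union>v<n. (\<lambda>u. {v, u}) ` N v)"
    proof
      fix e assume "e \<in> R"
      then have e: "e \<subseteq> {..<n}" "card e = 2"
        using col by (auto simp: two_edge_coloring_def all_edges_def)
      then obtain v u where "e = {v, u}"
        by (auto simp: card_2_iff)
      then show "e \<in> (\<Union>v<n. (\<lambda>u. {v, u}) ` N v)"
        using e(1) \<open>e \<in> R\<close> by (auto simp: N_def)
    qed
    then have "card R \<le> card (\<Union>v<n. (\<lambda>u. {v, u}) ` N v)"
      by (intro card_mono) (use N(2) in auto)
    also have "\<dots> \<le> (\<Sum>v<n. card ((\<lambda>u. {v, u}) ` N v))"
      by (rule card_UN_le) simp
    also have "\<dots> \<le> (\<Sum>v<n. card (N v))"
      by (intro sum_mono card_image_le N(2))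
    finally have "real (card R) \<le> (\<Sum>v<n. real (card (N v)))"
      by (simp flip: of_nat_sum)
    with sum_le show ?thesis
      by linarith
  qed
  moreover have "real s * (2 + M) > 0"
    using assms by (simp add: M_def add_pos_nonneg)
  ultimately show ?thesis
    by (intro exI[of _ "real s * (2 + M)"]) blast
qed

text \<open>By \<open>opposite_cliques_force_split\<close> some colour has no clique on
  \<open>r\<close> vertices. Its edge count is bounded by \<open>few_edges_without_clique\<close>,
  and the smaller class is no larger.\<close>

lemma avoiding_sizes_upper:
  assumes "s > 0"
  shows "\<exists>C>0. \<forall>n>0. \<forall>m\<in>avoiding_sizes n (family_st s t).
    real m \<le> C * real n powr (2 - 1 / real s)"
proof -
  obtain r where r: "\<And>n R B P Q. two_edge_coloring n R B \<Longrightarrow> P \<subseteq> {..<n} \<Longrightarrow> Q \<subseteq> {..<n} \<Longrightarrow>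
    card P = r \<Longrightarrow> card Q = r \<Longrightarrow> clique P R \<Longrightarrow> indep Q R \<Longrightarrow>
    has_induced_mono n R B (complete_split t t)"
    using opposite_cliques_force_split[of t] by blast
  obtain C where C: "C > 0" "\<And>n R B. n > 0 \<Longrightarrow> two_edge_coloring n R B \<Longrightarrow>
    (\<And>P. P \<subseteq> {..<n} \<Longrightarrow> card P = r \<Longrightarrow> \<not> clique P R) \<Longrightarrow>
    \<not> has_induced_mono n R B (complete_bipartite s t) \<Longrightarrow>
    real (card R) \<le> C * real n powr (2 - 1 / real s)"
    using few_edges_without_clique[OF assms, of r t] by metis
  have "real m \<le> C * real n powr (2 - 1 / real s)"
    if n: "n > 0" and m: "m \<in> avoiding_sizes n (family_st s t)" for n m
  proof -
    obtain R B where col: "two_edge_coloring n R B" and m_eq: "m = min (card R) (card B)"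
      and no: "\<not> has_induced_mono n R B (complete_bipartite s t)"
        "\<not> has_induced_mono n R B (complete_split t t)"
      using m by (auto simp: avoiding_sizes_def family_st_def)
    show ?thesis
    proof (cases "\<exists>P\<subseteq>{..<n}. card P = r \<and> clique P R")
      case False
      then have "real (card R) \<le> C * real n powr (2 - 1 / real s)"
        by (intro C(2)[OF n col _ no(1)]) blast
      then show ?thesis
        by (simp add: m_eq)
    next
      case True
      then obtain P where P: "P \<subseteq> {..<n}" "card P = r" "clique P R"
        by blast
      have "\<not> clique Q B" if Q: "Q \<subseteq> {..<n}" "card Q = r" for Q
      proof
        assume "clique Q B"
        then have "indep Q R"
          using two_edge_coloring_edge[OF col] Q(1) by (auto simp: clique_def indep_def subset_iff)
        then show False
          using r[OF col P(1) Q(1) P(2) Q(2) P(3)] no(2) by blast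
      qed
      then have "real (card B) \<le> C * real n powr (2 - 1 / real s)"
        using col no(1) by (intro C(2)[of n B R, OF n])
          (simp_all add: two_edge_coloring_commute[of n B] has_induced_mono_commute[of n B])
      then show ?thesis
        by (simp add: m_eq)
    qed
  qed
  with C(1) show ?thesis
    by blast
qed

section \<open>Colourings without the patterns\<close>

lemma sgraph_iso_inverse:
  assumes "sgraph_iso (induced_on U E) H"
  obtains g where "bij_betw g (verts H) U"
    "\<And>p q. p \<in> verts H \<Longrightarrow> q \<in> verts H \<Longrightarrow> {g p, g q} \<in> E \<longleftrightarrow> {p, q} \<in> edges H"
proof -
  obtain f where f: "bij_betw f U (verts H)"
    "\<And>u v. u \<in> U \<Longrightarrow> v \<in> U \<Longrightarrow> {u, v} \<in> E \<longleftrightarrow> {f u, f v} \<in> edges H"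
    using assms unfolding sgraph_iso_def by (auto simp: induced_on_simps)
  let ?g = "inv_into U f"
  have g: "bij_betw ?g (verts H) U"
    using f(1) by (rule bij_betw_inv_into)
  have "f (?g p) = p" if "p \<in> verts H" for p
    using bij_betw_inv_into_right[OF f(1) that] .
  then have "{?g p, ?g q} \<in> E \<longleftrightarrow> {p, q} \<in> edges H" if "p \<in> verts H" "q \<in> verts H" for p q
    using f(2)[of "?g p" "?g q"] bij_betwE[OF g] that by simp
  with g show thesis
    by (rule that)
qed

text \<open>In red, \<open>bip\<close> excludes the bipartite pattern, and the clique of the split
  pattern contains a triangle. In a blue copy of either pattern the \<open>t \<ge> 3\<close>
  vertices tagged \<open>Inr\<close> are pairwise red and again contain a red triangle.\<close>

lemma avoids_if_triangle_free:
  assumes col: "two_edge_coloring n R B" and t: "t \<ge> 3"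
    and tri: "\<And>x y z. {x, y} \<in> R \<Longrightarrow> {y, z} \<in> R \<Longrightarrow> {x, z} \<in> R \<Longrightarrow> False"
    and bip: "\<And>A W. A \<subseteq> {..<n} \<Longrightarrow> W \<subseteq> {..<n} \<Longrightarrow> card A = s \<Longrightarrow> card W = t \<Longrightarrow>
      (\<And>x y. x \<in> A \<Longrightarrow> y \<in> W \<Longrightarrow> {x, y} \<in> R) \<Longrightarrow> False"
    and H: "H \<in> family_st s t"
  shows "\<not> has_induced_mono n R B H"
proof
  assume "has_induced_mono n R B H"
  then obtain U where U: "U \<subseteq> {..<n}"
    "sgraph_iso (induced_on U R) H \<or> sgraph_iso (induced_on U B) H"
    unfolding has_induced_mono_def by blast
  define a where "a = (if H = complete_bipartite s t then s else t)"
  have verts: "verts H = {..<a} <+> {..<t}"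
    using H by (auto simp: family_st_def a_def verts_complete)
  show False
  proof (cases "sgraph_iso (induced_on U R) H")
    case True
    then obtain g where g: "bij_betw g (verts H) U"
      "\<And>p q. p \<in> verts H \<Longrightarrow> q \<in> verts H \<Longrightarrow> {g p, g q} \<in> R \<longleftrightarrow> {p, q} \<in> edges H"
      by (rule sgraph_iso_inverse) (rule that)
    show False
    proof (cases "H = complete_bipartite s t")
      case True
      have inj: "inj_on g ({..<s} <+> {..<t})"
        using g(1) verts True by (simp add: bij_betw_def a_def)
      have gU: "g p < n" if "p \<in> {..<s} <+> {..<t}" for p
        using bij_betwE[OF g(1)] that U(1) verts True by (auto simp: a_def)
      show False
      proof (rule bip)
        show "(\<lambda>i. g (Inl i)) ` {..<s} \<subseteq> {..<n}" "(\<lambda>j. g (Inr j)) ` {..<t} \<subseteq> {..<n}"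
          using gU by auto
        show "card ((\<lambda>i. g (Inl i)) ` {..<s}) = s"
        proof (subst card_image)
          show "inj_on (\<lambda>i. g (Inl i)) {..<s}"
            by (rule inj_onI) (use inj_onD[OF inj, of "Inl _" "Inl _"] in auto)
        qed simp
        show "card ((\<lambda>j. g (Inr j)) ` {..<t}) = t"
        proof (subst card_image)
          show "inj_on (\<lambda>j. g (Inr j)) {..<t}"
            by (rule inj_onI) (use inj_onD[OF inj, of "Inr _" "Inr _"] in auto)
        qed simp
        show "{x, y} \<in> R" if "x \<in> (\<lambda>i. g (Inl i)) ` {..<s}" "y \<in> (\<lambda>j. g (Inr j)) ` {..<t}" for x y
          using that g(2) by (auto simp: True verts_complete edge_complete_bipartite_iff)
      qed
    next
      case False
      then have H': "H = complete_split t t"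
        using H by (simp add: family_st_def)
      have "{g (Inl i), g (Inl j)} \<in> R" if "i < t" "j < t" "i \<noteq> j" for i j
        using g(2)[of "Inl i" "Inl j"] that by (auto simp: H' verts_complete edge_complete_split_iff)
      then show False
        using tri[of "g (Inl 0)" "g (Inl 1)" "g (Inl 2)"] t by simp
    qed
  next
    case False
    with U(2) have "sgraph_iso (induced_on U B) H"
      by simp
    then obtain g where g: "bij_betw g (verts H) U"
      "\<And>p q. p \<in> verts H \<Longrightarrow> q \<in> verts H \<Longrightarrow> {g p, g q} \<in> B \<longleftrightarrow> {p, q} \<in> edges H"
      by (rule sgraph_iso_inverse) (rule that)
    have "{g (Inr i), g (Inr j)} \<in> R" if ij: "i < t" "j < t" "i \<noteq> j" for i j
    proof -
      have v: "Inr i \<in> verts H" "Inr j \<in> verts H"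
        using ij verts by auto
      then have "g (Inr i) < n" "g (Inr j) < n" "g (Inr i) \<noteq> g (Inr j)"
        using bij_betwE[OF g(1)] U(1) inj_onD[OF bij_betw_imp_inj_on[OF g(1)] _ v] ij(3) by auto
      moreover have "{Inr i, Inr j} \<notin> edges H"
        using H by (auto simp: family_st_def edge_complete_bipartite_iff edge_complete_split_iff)
      ultimately show ?thesis
        using g(2)[OF v] two_edge_coloring_edge[OF col] by blast
    qed
    then show False
      using tri[of "g (Inr 0)" "g (Inr 1)" "g (Inr 2)"] t by simp
  qed
qed

text \<open>Red is the bipartite double cover of \<open>r\<close> on the vertices below
  \<open>2 * card V\<close>; all other pairs are blue. It has no triangle, and a red complete
  bipartite graph projects to two subsets of \<open>V\<close> as in \<open>free\<close>. The term
  \<open>n ^ 2 / 8\<close> bounds the number of blue edges from below.\<close>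

lemma avoiding_sizes_double_cover:
  fixes V :: "'a set" and r :: "'a \<Rightarrow> 'a \<Rightarrow> bool"
  assumes V: "finite V" "2 * card V \<le> n" and n: "n \<ge> 4" and s: "s > 0" and t: "t \<ge> 3"
    and sym: "\<And>v w. r v w \<longleftrightarrow> r w v"
    and reg: "\<And>v. v \<in> V \<Longrightarrow> card {w\<in>V. r v w} = d"
    and free: "\<And>D W. D \<subseteq> V \<Longrightarrow> W \<subseteq> V \<Longrightarrow> card D = s \<Longrightarrow> (\<forall>v\<in>D. \<forall>w\<in>W. r v w) \<Longrightarrow> card W < t"
  shows "\<exists>m\<in>avoiding_sizes n (family_st s t). real m \<ge> min (real (card V * d)) (real n ^ 2 / 8)"
proof -
  define c where "c = card V"
  obtain e where e: "bij_betw e {..<c} V"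
    using ex_bij_betw_nat_finite[OF V(1)] by (auto simp: c_def atLeast0LessThan)
  \<comment> \<open>Each related ordered pair is an edge of its own, joining \<open>i\<close> on the
    lower side to \<open>c + j\<close> on the upper one, so the edge count is
    \<open>card V * d\<close> without halving.\<close>
  define R where "R = (\<lambda>(i, j). {i, c + j}) ` (SIGMA i:{..<c}. {j. j < c \<and> r (e i) (e j)})"
  define B where "B = all_edges {..<n} - R"
  have R_iff: "{x, y} \<in> R \<longleftrightarrow> (\<exists>i<c. \<exists>j<c. r (e i) (e j) \<and> (x = i \<and> y = c + j \<or> x = c + j \<and> y = i))" for x y
    by (auto simp: R_def doubleton_eq_iff image_iff)
  have "R \<subseteq> all_edges {..<n}"
    using V(2) by (auto simp: R_def all_edges_def c_def)
  then have col: "two_edge_coloring n R B"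
    by (auto simp: two_edge_coloring_def B_def)
  have card_R: "card R = c * d"
  proof -
    have "card {j. j < c \<and> r (e i) (e j)} = d" if "i < c" for i
    proof -
      have "bij_betw e {j. j < c \<and> r (e i) (e j)} {w\<in>V. r (e i) w}"
        by (rule bij_betw_subset[OF e]) (use bij_betw_imp_surj_on[OF e] in auto)
      then show ?thesis
        using reg[of "e i"] bij_betwE[OF e] that by (simp add: bij_betw_same_card)
    qed
    moreover have "inj_on (\<lambda>(i, j). {i, c + j}) (SIGMA i:{..<c}. {j. j < c \<and> r (e i) (e j)})"
      by (auto simp: inj_on_def doubleton_eq_iff)
    ultimately show ?thesis
      unfolding R_def by (simp add: card_image)
  qed
  have tri: False if "{x, y} \<in> R" "{y, z} \<in> R" "{x, z} \<in> R" for x y z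
    using that unfolding R_iff by (elim exE conjE disjE) simp_all
  \<comment> \<open>The part of size \<open>s\<close> may lie on either side; the symmetry of
    \<open>r\<close> lets \<open>free\<close> apply to the image that has \<open>s\<close>
    elements.\<close>
  have part: False if AW: "A \<subseteq> {..<c}" "card A = a" "card W = b" "W \<subseteq> {c..<c + c}"
      "\<And>x y. x \<in> A \<Longrightarrow> y \<in> W \<Longrightarrow> r (e x) (e (y - c))" "a = s \<and> b = t \<or> a = t \<and> b = s" for A W a b
  proof -
    have inj: "inj_on e {..<c}"
      using e by (rule bij_betw_imp_inj_on)
    define W' where "W' = (\<lambda>y. y - c) ` W"
    have W': "W' \<subseteq> {..<c}"
      unfolding W'_def
    proof (rule image_subsetI)
      show "y - c \<in> {..<c}" if "y \<in> W" for y
        using subsetD[OF AW(4) that] by auto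
    qed
    have "inj_on (\<lambda>y. y - c) W"
      using AW(4) by (intro inj_onI) (metis atLeastLessThan_iff eq_diff_iff subset_iff)
    then have cards: "card (e ` A) = a" "card (e ` W') = b"
      using AW(2,3) inj_on_subset[OF inj AW(1)] inj_on_subset[OF inj W'] by (simp_all add: card_image W'_def)
    have sub: "e ` A \<subseteq> V" "e ` W' \<subseteq> V"
      using AW(1) W' bij_betw_imp_surj_on[OF e] by auto
    have "\<forall>v\<in>e ` A. \<forall>w\<in>e ` W'. r v w"
      using AW(5) by (auto simp: W'_def)
    moreover then have "\<forall>w\<in>e ` W'. \<forall>v\<in>e ` A. r w v"
      using sym by blast
    ultimately show False
      using AW(6) free[OF sub] free[OF sub(2,1)] cards by auto
  qed
  have "\<not> has_induced_mono n R B H" if "H \<in> family_st s t" for H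
  proof (rule avoids_if_triangle_free[OF col t tri _ that])
    fix A W assume AW: "A \<subseteq> {..<n}" "W \<subseteq> {..<n}" "card A = s" "card W = t"
      "\<And>x y. x \<in> A \<Longrightarrow> y \<in> W \<Longrightarrow> {x, y} \<in> R"
    have cross: "x < c \<and> c \<le> y \<and> y < c + c \<and> r (e x) (e (y - c)) \<or>
        y < c \<and> c \<le> x \<and> x < c + c \<and> r (e y) (e (x - c))" if "x \<in> A" "y \<in> W" for x y
      using AW(5)[OF that] unfolding R_iff by auto
    \<comment> \<open>All cross pairs are edges, so the side of \<open>x0\<close> fixes the side of
      all of \<open>W\<close>, and \<open>y0\<close> then that of all of \<open>A\<close>.\<close>
    obtain x0 y0 where x0: "x0 \<in> A" and y0: "y0 \<in> W"
      using AW(3,4) s t by (metis card.empty equals0I not_numeral_le_zero less_numeral_extra(3))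
    show False
    proof (cases "x0 < c")
      case True
      have y: "c \<le> y" if "y \<in> W" for y
        using cross[OF x0 that] True by auto
      then have x: "x < c" if "x \<in> A" for x
        using cross[OF that y0] y[OF y0] by auto
      show False
      proof (rule part[of A s W t])
        show "A \<subseteq> {..<c}"
          using x by auto
        show "W \<subseteq> {c..<c + c}"
          using cross[OF x0] True y by fastforce
        show "r (e x) (e (y - c))" if "x \<in> A" "y \<in> W" for x y
          using cross[OF that] x[OF that(1)] by auto
      qed (use AW in auto)
    next
      case False
      have y: "y < c" if "y \<in> W" for y
        using cross[OF x0 that] False by auto
      then have x: "c \<le> x" "x < c + c" if "x \<in> A" for x
        using cross[OF that y0] y[OF y0] by auto
      show False
      proof (rule part[of W t A s])
        show "W \<subseteq> {..<c}"
          using y by auto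
        show "A \<subseteq> {c..<c + c}"
          using x by auto
        show "r (e y) (e (x - c))" if "y \<in> W" "x \<in> A" for x y
          using cross[OF that(2,1)] x(1)[OF that(2)] by auto
      qed (use AW in auto)
    qed
  qed
  then have mem: "min (card R) (card B) \<in> avoiding_sizes n (family_st s t)"
    using col unfolding avoiding_sizes_def by blast
  have fin: "finite (all_edges {..<n})"
    by (rule finite_subset[of _ "Pow {..<n}"]) (auto simp: all_edges_def)
  have "card (all_edges {..<n}) = n choose 2"
    unfolding all_edges_def by (simp add: n_subsets)
  then have card_B: "card B = (n choose 2) - card R"
    using \<open>R \<subseteq> all_edges {..<n}\<close> fin by (simp add: B_def card_Diff_subset finite_subset)
  have "real (card R) \<le> real c * real c"
  proof (cases "V = {}")
    case False
    then obtain v where "v \<in> V"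
      by blast
    then have "d \<le> c"
      using reg[of v] card_mono[OF V(1), of "{w\<in>V. r v w}"] by (simp add: c_def)
    then show ?thesis
      unfolding card_R by (simp add: mult_left_mono)
  qed (simp add: card_R c_def)
  also have "\<dots> \<le> (real n / 2) * (real n / 2)"
    using V(2) by (intro mult_mono) (auto simp: c_def)
  finally have "real (card R) \<le> real n ^ 2 / 4"
    by (simp add: power2_eq_square)
  moreover have "real (n choose 2) = real n * (real n - 1) / 2"
    using n by (simp add: choose_two real_of_nat_div of_nat_diff)
  moreover have "real (card B) \<ge> real (n choose 2) - real (card R)"
    unfolding card_B by linarith
  \<comment> \<open>This is where \<open>n \<ge> 4\<close> enters: it makes
    \<open>n * (n - 1) / 2 - n ^ 2 / 4\<close> at least \<open>n ^ 2 / 8\<close>.\<close>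
  moreover have "real n * 4 \<le> real n * real n"
    using n by (intro mult_left_mono) auto
  ultimately have "real (card B) \<ge> real n ^ 2 / 8"
    by (simp add: power2_eq_square algebra_simps)
  then have "min (real (card V * d)) (real n ^ 2 / 8) \<le> real (min (card R) (card B))"
    unfolding of_nat_min by (intro min.mono) (simp_all add: card_R c_def)
  with mem show ?thesis
    by blast
qed

section \<open>Lower bounds from a matching and from norm graphs\<close>

lemma avoiding_sizes_lower_1:
  assumes t: "t \<ge> 3" and n: "n \<ge> 4"
  shows "\<exists>m\<in>avoiding_sizes n (family_st 1 t). real m \<ge> 1 / 4 * real n"
proof -
  \<comment> \<open>The double cover of equality is a matching with \<open>n div 2\<close> edges, of
    linear size as the exponent for \<open>s = 1\<close> asks.\<close>
  have m: "\<exists>m\<in>avoiding_sizes n (family_st 1 t).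
      real m \<ge> min (real (card {..<n div 2} * 1)) (real n ^ 2 / 8)"
  proof (rule avoiding_sizes_double_cover[where r = "(=)"])
    show "card {w \<in> {..<n div 2}. v = w} = 1" if "v \<in> {..<n div 2}" for v
    proof -
      have "{w \<in> {..<n div 2}. v = w} = {v}"
        using that by auto
      then show ?thesis
        by simp
    qed
    show "card W < t" if "card D = 1" "\<forall>v\<in>D. \<forall>w\<in>W. v = w" for D W :: "nat set"
    proof -
      obtain v where "D = {v}"
        using \<open>card D = 1\<close> by (rule card_1_singletonE)
      with that(2) have "W \<subseteq> {v}"
        by auto
      then have "card W \<le> card {v}"
        by (intro card_mono) auto
      with t show ?thesis
        by simp
    qed
  qed (use t n in auto)
  have "1 / 4 * real n \<le> real (card {..<n div 2} * 1)"
    using n by simp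
  moreover have "1 / 4 * real n \<le> real n ^ 2 / 8"
  proof -
    have "real n * 2 \<le> real n * real n"
      using n by (intro mult_left_mono) auto
    then show ?thesis
      by (simp add: power2_eq_square)
  qed
  ultimately have "1 / 4 * real n \<le> min (real (card {..<n div 2} * 1)) (real n ^ 2 / 8)"
    by (rule min.boundedI)
  with m show ?thesis
    by (meson order.trans)
qed

text \<open>With \<open>s = Suc k\<close> and a power of two \<open>q\<close> such that
  \<open>2 * q ^ s \<le> n < 2 ^ Suc s * q ^ s\<close>, the double cover of the norm graph fits into
  \<open>n\<close> vertices and has about \<open>q ^ (2 * s - 1)\<close> edges, which is of order
  \<open>n powr (2 - 1 / s)\<close>.\<close>

lemma avoiding_sizes_lower_Suc:
  assumes k: "k > 0" and t: "t \<ge> 3" "t > fact k"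
  shows "\<exists>c>0. \<forall>n \<ge> 2 * 2 ^ Suc k. \<exists>m\<in>avoiding_sizes n (family_st (Suc k) t).
    real m \<ge> c * real n powr (2 - 1 / real (Suc k))"
proof -
  define s where "s = Suc k"
  define K where "K = (2 ^ Suc s) powr (2 - 1 / real s)"
  have K: "K > 0"
    by (simp add: K_def)
  \<comment> \<open>\<open>K\<close> pays for rounding \<open>n\<close> down to
    \<open>q ^ s\<close>, and the \<open>4\<close> for \<open>q - 1 \<ge> q / 2\<close> and
    \<open>q ^ k - 1 \<ge> q ^ k / 2\<close>. The value \<open>1 / 8\<close> serves the comparison
    with \<open>n ^ 2 / 8\<close>.\<close>
  define c where "c = min (1 / (4 * K)) (1 / 8)"
  have "real s > 0"
    by (simp add: s_def)
  have "\<exists>m\<in>avoiding_sizes n (family_st s t). real m \<ge> c * real n powr (2 - 1 / real s)"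
    if n: "n \<ge> 2 * 2 ^ s" for n
  proof -
    have n4: "n \<ge> 4"
    proof -
      have "(2 :: nat) ^ 1 \<le> 2 ^ s"
        by (intro power_increasing) (auto simp: s_def)
      with n show ?thesis
        by simp
    qed
    \<comment> \<open>The exponent just before \<open>P\<close> first holds gives the largest power
      of two that fits; \<open>n \<ge> 2 * 2 ^ s\<close> ensures \<open>m > 0\<close>, so that
      \<open>q \<ge> 2\<close>.\<close>
    define P where "P = (\<lambda>m. n < 2 * (2 ^ m) ^ s)"
    have "P n"
    proof -
      have "n < 2 ^ n"
        by (rule less_exp)
      also have "\<dots> \<le> (2 ^ n) ^ s"
        by (rule self_le_power) (auto simp: s_def)
      finally show ?thesis
        by (simp add: P_def)
    qed
    moreover have "\<not> P 0"
      using n4 by (simp add: P_def)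
    ultimately have "\<exists>m<n. (\<forall>i\<le>m. \<not> P i) \<and> P (Suc m)"
      by (rule ex_least_nat_less)
    then obtain m where m: "\<forall>i\<le>m. \<not> P i" "P (Suc m)"
      by (elim exE conjE) (rule that)
    have "\<not> P 1"
      using n by (simp add: P_def)
    with m(2) have "m > 0"
      by (cases m) auto
    define q :: nat where "q = 2 ^ m"
    have q2: "q \<ge> 2"
      using self_le_power[of 2 m] \<open>m > 0\<close> by (simp add: q_def)
    have n_ge: "2 * q ^ s \<le> n"
      using m(1) by (simp add: P_def q_def not_less)
    have n_less: "n < 2 ^ Suc s * q ^ s"
      using m(2) by (simp add: P_def q_def power_mult_distrib mult_ac)
    obtain V :: "(bit alg_closure \<times> bit alg_closure) set" and r where
      V: "finite V" "card V = q ^ k * (q - 1)" and sym: "\<forall>v w. r v w \<longleftrightarrow> r w v"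
      and reg: "\<forall>v\<in>V. card {w\<in>V. r v w} = q ^ k - 1"
      and free: "\<forall>D W. D \<subseteq> V \<longrightarrow> W \<subseteq> V \<longrightarrow> card D = Suc k \<longrightarrow>
        (\<forall>v\<in>D. \<forall>w\<in>W. r v w) \<longrightarrow> card W \<le> fact k"
      using norm_graph_exists[OF k \<open>m > 0\<close>, folded q_def] by (elim exE conjE) (rule that)
    have "q ^ k * (q - 1) \<le> q ^ s"
      by (simp add: s_def mult.commute)
    then have "2 * card V \<le> n"
      using n_ge V(2) by linarith
    then have "\<exists>m\<in>avoiding_sizes n (family_st s t).
        real m \<ge> min (real (card V * (q ^ k - 1))) (real n ^ 2 / 8)"
    proof (rule avoiding_sizes_double_cover[OF V(1) _ n4 _ t(1)])
      show "card W < t" if "D \<subseteq> V" "W \<subseteq> V" "card D = s" "\<forall>v\<in>D. \<forall>w\<in>W. r v w" for D W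
        using free[rule_format, OF that(1,2) _ that(4)[rule_format]] that(3) t(2) by (simp add: s_def)
      show "r v w \<longleftrightarrow> r w v" for v w
        using sym by blast
      show "card {w\<in>V. r v w} = q ^ k - 1" if "v \<in> V" for v
        using reg that by blast
    qed (auto simp: s_def)
    then obtain m' where m': "m' \<in> avoiding_sizes n (family_st s t)"
      "real m' \<ge> min (real (card V * (q ^ k - 1))) (real n ^ 2 / 8)"
      by blast
    have "c * real n powr (2 - 1 / real s) \<le> real (card V * (q ^ k - 1))"
    proof -
      have "real n powr (2 - 1 / real s) \<le> (2 ^ Suc s * real q ^ s) powr (2 - 1 / real s)"
      proof (rule powr_mono2)
        have "real n \<le> real (2 ^ Suc s * q ^ s)"
          using n_less by (simp only: of_nat_le_iff less_imp_le)
        then show "real n \<le> 2 ^ Suc s * real q ^ s"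
          by simp
      qed (auto simp: s_def divide_simps)
      also have "\<dots> = K * (real q ^ s) powr (2 - 1 / real s)"
        by (simp add: K_def powr_mult)
      also have "(real q ^ s) powr (2 - 1 / real s) = real q powr (real s * (2 - 1 / real s))"
        using q2 by (simp add: powr_powr[symmetric] powr_realpow)
      also have "real s * (2 - 1 / real s) = 2 * real s - 1"
        using \<open>real s > 0\<close> by (simp add: right_diff_distrib)
      also have "\<dots> = real (s + k)"
        by (simp add: s_def)
      also have "real q powr real (s + k) = real q ^ (s + k)"
        using q2 by (simp add: powr_realpow del: of_nat_add)
      finally have le: "real n powr (2 - 1 / real s) \<le> K * real q ^ (s + k)" .
      have "c * real n powr (2 - 1 / real s) \<le> 1 / (4 * K) * (K * real q ^ (s + k))"
        by (intro mult_mono le) (use K in \<open>auto simp: c_def\<close>)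
      also have "\<dots> = real q ^ k * (real q / 2) * (real q ^ k / 2)"
        using K by (simp add: s_def power_add)
      also have "\<dots> \<le> real q ^ k * real (q - 1) * real (q ^ k - 1)"
      proof (intro mult_mono order.refl)
        show "real q / 2 \<le> real (q - 1)"
          using q2 by (simp add: of_nat_diff)
        have "q ^ 1 \<le> q ^ k"
          by (rule power_increasing) (use k q2 in auto)
        with q2 have "2 \<le> q ^ k"
          by simp
        then have "real 2 \<le> real (q ^ k)" "1 \<le> q ^ k"
          by (simp_all only: of_nat_le_iff)
        then show "real q ^ k / 2 \<le> real (q ^ k - 1)"
          by (simp add: of_nat_diff)
      qed auto
      finally show ?thesis
        by (simp add: V(2))
    qed
    moreover have "c * real n powr (2 - 1 / real s) \<le> real n ^ 2 / 8"
    proof -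
      have "real n powr (2 - 1 / real s) \<le> real n powr 2"
        using n4 by (intro powr_mono) auto
      also have "\<dots> = real n ^ 2"
        using n4 by simp
      finally have "c * real n powr (2 - 1 / real s) \<le> 1 / 8 * real n ^ 2"
        by (intro mult_mono) (auto simp: c_def)
      then show ?thesis
        by simp
    qed
    ultimately show ?thesis
      using m' by (intro bexI[OF _ m'(1)]) linarith
  qed
  moreover have "c > 0"
    using K by (simp add: c_def)
  ultimately show ?thesis
    unfolding s_def by blast
qed

lemma avoiding_sizes_lower:
  assumes "s \<ge> 1" "t \<ge> 3" "t > fact (s - 1)"
  shows "\<exists>c>0. \<forall>\<^sub>F n in sequentially. \<exists>m\<in>avoiding_sizes n (family_st s t).
    real m \<ge> c * real n powr (2 - 1 / real s)"
proof (cases "s = 1")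
  case True
  have "\<forall>\<^sub>F n in sequentially. \<exists>m\<in>avoiding_sizes n (family_st s t).
      real m \<ge> 1 / 4 * real n powr (2 - 1 / real s)"
    using eventually_ge_at_top[of 4]
  proof eventually_elim
    case (elim n)
    then show ?case
      using avoiding_sizes_lower_1[OF assms(2) elim] True by simp
  qed
  then show ?thesis
    by (intro exI[of _ "1 / 4"]) simp
next
  case False
  then obtain k where k: "s = Suc k" "k > 0"
    using assms(1) by (cases s) auto
  obtain c where "c > 0" and c: "\<forall>n \<ge> 2 * 2 ^ Suc k. \<exists>m\<in>avoiding_sizes n (family_st (Suc k) t).
    real m \<ge> c * real n powr (2 - 1 / real (Suc k))"
    using avoiding_sizes_lower_Suc[OF k(2) assms(2)] assms(3) k(1) by auto
  have "\<forall>\<^sub>F n in sequentially. \<exists>m\<in>avoiding_sizes n (family_st s t).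
      real m \<ge> c * real n powr (2 - 1 / real s)"
    using eventually_ge_at_top[of "2 * 2 ^ Suc k"]
    by eventually_elim (use c k(1) in blast)
  with \<open>c > 0\<close> show ?thesis
    by blast
qed

section \<open>From avoiding sizes to the extremal number\<close>

lemma the_enat_Sup_enat:
  assumes "finite A" "A \<noteq> {}"
  shows "the_enat (Sup (enat ` A)) = Max A"
proof -
  have "Sup (enat ` A) = Max (enat ` A)"
    using assms by (intro Max_Sup[symmetric]) auto
  also have "\<dots> = enat (Max A)"
    using assms by (intro mono_Max_commute[symmetric] monoI) auto
  finally show ?thesis
    by simp
qed

lemma half_choose_two_ge:
  assumes "n \<ge> 4"
  shows "real n ^ 2 / 8 \<le> real ((n choose 2) div 2)"
proof -
  have "real (n choose 2) = real n * (real n - 1) / 2"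
    using assms by (simp add: choose_two real_of_nat_div of_nat_diff)
  moreover have "real (n choose 2) \<le> 2 * real ((n choose 2) div 2) + 1"
    by linarith
  moreover have "4 * real n \<le> real n * real n"
    using assms by (intro mult_right_mono) auto
  moreover have "real n * (real n - 1) = real n * real n - real n"
    by (simp add: algebra_simps)
  moreover have "4 \<le> real n"
    using assms by simp
  ultimately have "real n * real n / 8 \<le> real ((n choose 2) div 2)"
    by linarith
  then show ?thesis
    by (simp add: power2_eq_square)
qed

theorem theorem2p3:
  fixes s t :: nat
  assumes "s \<ge> 1" and "t \<ge> 1" and "t \<ge> max 3 (fact (s - 1) + 1)"
  shows "(\<forall>\<^sub>F n in sequentially. ex2 n (family_st s t) \<noteq> \<infinity>) \<and>
         (\<lambda>n. real (the_enat (ex2 n (family_st s t)))) \<in> \<Theta>(\<lambda>n. real n powr (2 - 1 / real s))"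
proof -
  have t: "t \<ge> 3" "t > fact (s - 1)"
    using order.trans[OF max.cobounded1 assms(3)] order.trans[OF max.cobounded2 assms(3)] by auto
  define S where "S = (\<lambda>n. avoiding_sizes n (family_st s t))"
  define f where "f = (\<lambda>n. real n powr (2 - 1 / real s))"
  obtain C where "C > 0" and C: "\<And>n m. n > 0 \<Longrightarrow> m \<in> S n \<Longrightarrow> real m \<le> C * f n"
    using avoiding_sizes_upper[of s t] assms(1) by (auto simp: S_def f_def)
  obtain c where "c > 0" and c: "\<forall>\<^sub>F n in sequentially. \<exists>m\<in>S n. real m \<ge> c * f n"
    using avoiding_sizes_lower[OF assms(1) t] unfolding S_def f_def by blast
  \<comment> \<open>Since \<open>f n * n powr (1 / s)\<close> is \<open>n ^ 2\<close>, the bound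
    \<open>C * f n\<close> eventually falls below \<open>n ^ 2 / 8\<close> and so below
    \<open>(n choose 2) div 2\<close>. The value that would make \<open>ex2\<close> infinite is then
    not attained.\<close>
  have "filterlim (\<lambda>n. real n powr (1 / real s)) at_top sequentially"
    using assms(1) by real_asymp
  then have "\<forall>\<^sub>F n in sequentially. 8 * C < real n powr (1 / real s)"
    by (simp add: filterlim_at_top_dense)
  then have ex2: "\<forall>\<^sub>F n in sequentially. ex2 n (family_st s t) = Sup (enat ` S n)"
    using eventually_ge_at_top[of 4]
  proof eventually_elim
    case (elim n)
    have "C * f n < f n * real n powr (1 / real s) / 8"
      using elim by (simp add: f_def)
    also have "f n * real n powr (1 / real s) = real n ^ 2"
      using elim(2) by (simp add: f_def powr_add[symmetric])
    also have "\<dots> / 8 \<le> real ((n choose 2) div 2)"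
      using elim(2) by (rule half_choose_two_ge)
    finally have "\<not> real ((n choose 2) div 2) \<le> C * f n"
      by simp
    then have "(n choose 2) div 2 \<notin> S n"
      using C elim(2) by auto
    then show ?case
      by (simp add: ex2_def S_def)
  qed
  have fin: "finite (S n)" for n
    by (rule finite_subset[of _ "{..n choose 2}"]) (auto simp: S_def dest: avoiding_sizes_le)
  \<comment> \<open>The lower bound also shows that \<open>S n\<close> is eventually nonempty, so
    the supremum is a maximum and finite.\<close>
  from ex2 c have "\<forall>\<^sub>F n in sequentially. ex2 n (family_st s t) \<noteq> \<infinity>"
  proof eventually_elim
    case (elim n)
    then have "Sup (enat ` S n) = Max (enat ` S n)"
      using fin[of n] by (intro Max_Sup[symmetric]) auto
    also have "\<dots> \<in> enat ` S n"
      using elim fin[of n] by (intro Max_in) auto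
    finally show ?case
      using elim(1) by auto
  qed
  moreover have "(\<lambda>n. real (the_enat (ex2 n (family_st s t)))) \<in> \<Theta>(f)"
  proof (rule bigthetaI'[OF \<open>c > 0\<close> \<open>C > 0\<close>])
    show "\<forall>\<^sub>F n in sequentially. c * norm (f n) \<le> norm (real (the_enat (ex2 n (family_st s t)))) \<and>
        norm (real (the_enat (ex2 n (family_st s t)))) \<le> C * norm (f n)"
      using ex2 c eventually_gt_at_top[of 0]
    proof eventually_elim
      case (elim n)
      obtain m where m: "m \<in> S n" "real m \<ge> c * f n"
        using elim(2) by blast
      then have eq: "the_enat (ex2 n (family_st s t)) = Max (S n)"
        using elim(1) the_enat_Sup_enat[OF fin] by auto
      have "m \<le> Max (S n)"
        using fin m(1) by (rule Max_ge)
      then have "real m \<le> real (Max (S n))"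
        by simp
      moreover have "Max (S n) \<in> S n"
        using fin m(1) by (intro Max_in) auto
      then have "real (Max (S n)) \<le> C * f n"
        using elim(3) by (intro C)
      moreover have "norm (f n) = f n"
        by (simp add: f_def)
      ultimately show ?case
        using m(2) by (simp add: eq)
    qed
  qed
  ultimately show ?thesis
    by (simp add: f_def)
qed

end
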